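(* Let $n\geqslant 1$. For any integer $\ell$ with $0<\ell\leqslant n$, $$X_\ell^{2^\ell-1}x_\ell^{2^\ell}\simeq_{\ell}\sum_{u=\ell}^n\ \sum_{(i;I)\in\mathcal N_{\ell-1}}\phi_{(i;I\cup u)}(X^{2^\ell-1})\,x_u^{2^\ell}+\sum_{u=\ell+1}^n X_u^{2^\ell-1}x_u^{2^\ell}.$$
   Context: $P_n=\mathbb F_2[x_1,\ldots,x_n]$, $\deg x_i=1$, is a module over the mod-2 Steenrod algebra $\mathcal A$ in the usual way ($Sq^0=\mathrm{id}$, $Sq^1(x_i)=x_i^2$, $Sq^k(x_i)=0$ for $k>1$, Cartan formula). $X_j=\prod_{1\leqslant m\leqslant n,\,m\ne j}x_m\in P_n$ for $1\leqslant j\leqslant n$, and $X=x_1x_2\cdots x_{n-1}\in P_{n-1}$. For a monomial $x=x_1^{a_1}\cdots x_n^{a_n}$ write $\nu_t(x)=a_t$. For $a\geqslant 0$, $\alpha_i(a)\in\{0,1\}$ is the $i$-th dyadic digit, $a=\sum_{i\geqslant 0}\alpha_i(a)2^i$. The weight vector of $x$ is $\omega(x)=(\omega_1(x),\omega_2(x),\ldots)$ with $\omega_i(x)=\sum_j\alpha_{i-1}(\nu_j(x))$. Weight vectors (eventually zero sequences of non-negative integers) are ordered left lexicographically, and $\deg\omega=\sum_{i>0}2^{i-1}\omega_i$. $P_n^-(\omega)$ is the span of all monomials $y\in P_n$ with $\deg y=\deg\omega$ and $\omega(y)<\omega$. $\mathcal A_s^+$ is the span of all $Sq^j$ with $1\leqslant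 j<2^s$. For $f,g\in P_n$ of the same degree, $f\simeq_{(s,\omega)}g$ means $f-g\in\mathcal A_s^+P_n+P_n^-(\omega)$; for a monomial $x$, $x\simeq_s g$ means $x\simeq_{(s,\omega(x))}g$. $\mathcal N_m=\{(i;I): I=(i_1,\ldots,i_r),\ 1\leqslant i<i_1<\cdots<i_r\leqslant m,\ 0\leqslant r<m\}$, with $\mathcal N_0=\emptyset$; $\mathcal N_m \subset \mathcal N_n$ for $m\leqslant n$. $\ell(I)=r$ is the length of $I$. $I\cup u$ is the increasing sequence whose set of entries is that of $I$ together with $u$. For $1\leqslant i\leqslant n$, $f_i:P_{n-1}\to P_n$ is the algebra homomorphism with $f_i(x_j)=x_j$ for $j<i$ and $f_i(x_j)=x_{j+1}$ for $i\leqslant j<n$. Let $(i;I)\in\mathcal N_n$ with $r=\ell(I)>0$ and $1\leqslant u\leqslant r$. A monomial $x\in P_{n-1}$ is $u$-compatible with $(i;I)$ if: (i) $\nu_{i_1-1}(x)=\cdots=\nu_{i_{u-1}-1}(x)=2^r-1$; (ii) $\nu_{i_u-1}(x)>2^r-1$; (iii) $\alpha_{r-t}(\nu_{i_u-1}(x))=1$ for $1\leqslant t\leqslant u$; (iv) $\alpha_{r-t}(\nu_{i_t-1}(x))=1$ for $u<t\leqslant r$. (At most one such $u$ exists.) Put $x_{(I,u)}=x_{i_u}^{2^{r-1}+\cdots+2^{r-u}}\prod_{u<t\leqslant r}x_{i_t}^{2^{r-t}}$. The $\mathbb F_2$-linear map $\phi_{(i;I)}:P_{n-1}\to P_n$ is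 given on monomials by $\phi_{(i;I)}(x)=x_i^{2^r-1}f_i(x)/x_{(I,u)}$ if $x$ is $u$-compatible with $(i;I)$ for some $u$, and $\phi_{(i;I)}(x)=0$ otherwise; $\phi_{(i;\emptyset)}=f_i$. *)

theory Defs
  imports
    "HOL-Library.Poly_Mapping"
    "HOL-Library.Z2"
    "HOL-Computational_Algebra.Polynomial"
begin

section \<open>Polynomials over the field with two elements\<close>

text \<open>
  Exponent vectors are finitely supported functions \<open>nat \<Rightarrow> nat\<close>, so \<open>pol\<close> is the polynomial ring
  over \<open>F\<^sub>2\<close> in the variables \<open>x\<^sub>0, x\<^sub>1, x\<^sub>2, \<dots>\<close>. The ring \<open>P\<^sub>n\<close> is \<open>Pol n\<close>, the subring of the
  polynomials in which only \<open>x\<^sub>1, \<dots>, x\<^sub>n\<close> occur.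
\<close>

type_synonym expo = "nat \<Rightarrow>\<^sub>0 nat"
type_synonym pol = "(nat \<Rightarrow>\<^sub>0 nat) \<Rightarrow>\<^sub>0 bit"

abbreviation nu :: "nat \<Rightarrow> expo \<Rightarrow> nat"
  where "nu t a \<equiv> Poly_Mapping.lookup a t"

definition mon :: "expo \<Rightarrow> pol"
  where "mon a = Poly_Mapping.single a 1"

definition var :: "nat \<Rightarrow> pol"
  where "var j = mon (Poly_Mapping.single j 1)"

definition Pol :: "nat \<Rightarrow> pol set"
  where "Pol n = {f. \<forall>a \<in> Poly_Mapping.keys f. Poly_Mapping.keys a \<subseteq> {1..n}}"

definition deg_expo :: "expo \<Rightarrow> nat"
  where "deg_expo a = (\<Sum>j \<in> Poly_Mapping.keys a. nu j a)"

definition homogeneous :: "nat \<Rightarrow> pol \<Rightarrow> bool"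
  where "homogeneous d f \<longleftrightarrow> (\<forall>a \<in> Poly_Mapping.keys f. deg_expo a = d)"

definition scal :: "bit \<Rightarrow> pol \<Rightarrow> pol"
  where "scal c f = Poly_Mapping.single 0 c * f"

text \<open>
  The default simplifier setup rewrites sums in \<open>bit\<close> to \<open>of_bool\<close> expressions, which blocks
  algebraic reasoning.
\<close>

declare add_bit_eq_xor [simp del] mult_bit_eq_and [simp del]

lemma scal_0 [simp]: "scal 0 f = 0"
  by (simp add: scal_def)

lemma scal_1 [simp]: "scal 1 f = f"
  by (simp add: scal_def)

global_interpretation F2: vector_space scal
proof
  fix a b :: bit and f g :: pol
  show "scal a (f + g) = scal a f + scal a g"
    by (simp add: scal_def algebra_simps)
  show "scal (a + b) f = scal a f + scal b f"
    by (simp add: scal_def single_add algebra_simps)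
  show "scal a (scal b f) = scal (a * b) f"
    by (simp add: scal_def mult_single mult.assoc[symmetric])
  show "scal 1 f = f"
    by simp
qed

lemma pol_add_self [simp]: "f + f = (0 :: pol)"
  using F2.scale_left_distrib[of 1 1 f] by simp

lemma pol_eq_sum_mon: "f = (\<Sum>a \<in> Poly_Mapping.keys f. mon a)"
proof (rule poly_mapping_eqI)
  fix k
  have "Poly_Mapping.lookup (\<Sum>a \<in> Poly_Mapping.keys f. mon a) k
      = (\<Sum>a \<in> Poly_Mapping.keys f. if a = k then 1 else 0)"
    by (auto simp: lookup_sum mon_def lookup_single when_def intro!: sum.cong)
  also have "\<dots> = Poly_Mapping.lookup f k"
    by (auto simp: in_keys_iff)
  finally show "Poly_Mapping.lookup f k
      = Poly_Mapping.lookup (\<Sum>a \<in> Poly_Mapping.keys f. mon a) k"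
    by simp
qed


subsection \<open>Evaluation homomorphisms\<close>

text \<open>
  \<open>evalp \<iota> \<sigma>\<close> is the ring homomorphism given by \<open>\<iota>\<close> on the coefficients and sending \<open>x\<^sub>j\<close> to \<open>\<sigma> j\<close>.
\<close>

definition evalp :: "(bit \<Rightarrow> 'r) \<Rightarrow> (nat \<Rightarrow> 'r) \<Rightarrow> pol \<Rightarrow> 'r::comm_ring_1"
  where "evalp \<iota> \<sigma> f = (\<Sum>a \<in> Poly_Mapping.keys f.
    \<iota> (Poly_Mapping.lookup f a) * (\<Prod>j \<in> Poly_Mapping.keys a. \<sigma> j ^ nu j a))"

context
  fixes \<iota> :: "bit \<Rightarrow> 'r::comm_ring_1" and \<sigma> :: "nat \<Rightarrow> 'r"
  assumes zero: "\<iota> 0 = 0" and one: "\<iota> 1 = 1"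
    and add: "\<And>a b. \<iota> (a + b) = \<iota> a + \<iota> b"
begin

lemma iota_mult: "\<iota> (a * b) = \<iota> a * \<iota> b"
  by (cases a; cases b) (simp_all add: zero one)

lemma evalp_add: "evalp \<iota> \<sigma> (f + g) = evalp \<iota> \<sigma> f + evalp \<iota> \<sigma> g"
proof -
  let ?K = "Poly_Mapping.keys f \<union> Poly_Mapping.keys g"
  let ?M = "\<lambda>a. \<Prod>j \<in> Poly_Mapping.keys a. \<sigma> j ^ nu j a"
  have *: "evalp \<iota> \<sigma> h = (\<Sum>a \<in> ?K. \<iota> (Poly_Mapping.lookup h a) * ?M a)"
    if "Poly_Mapping.keys h \<subseteq> ?K" for h
    unfolding evalp_def using that
    by (intro sum.mono_neutral_left) (auto simp del: bit_not_zero_iff simp: in_keys_iff zero)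
  show ?thesis
    using keys_add[of f g]
    by (simp add: * lookup_add add distrib_right sum.distrib)
qed

lemma evalp_sum: "evalp \<iota> \<sigma> (sum f A) = (\<Sum>i \<in> A. evalp \<iota> \<sigma> (f i))"
  by (induction A rule: infinite_finite_induct) (simp_all add: evalp_add, simp_all add: evalp_def)

lemma evalp_mon: "evalp \<iota> \<sigma> (mon a) = (\<Prod>j \<in> Poly_Mapping.keys a. \<sigma> j ^ nu j a)"
  by (simp add: evalp_def mon_def one)

lemma evalp_var: "evalp \<iota> \<sigma> (var j) = \<sigma> j"
  by (simp add: var_def evalp_mon)

lemma evalp_mon_add: "evalp \<iota> \<sigma> (mon (a + b)) = evalp \<iota> \<sigma> (mon a) * evalp \<iota> \<sigma> (mon b)"
proof -
  let ?K = "Poly_Mapping.keys a \<union> Poly_Mapping.keys b"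
  have *: "evalp \<iota> \<sigma> (mon c) = (\<Prod>j \<in> ?K. \<sigma> j ^ nu j c)"
    if "Poly_Mapping.keys c \<subseteq> ?K" for c
    unfolding evalp_mon using that
    by (intro prod.mono_neutral_left) (auto simp: in_keys_iff)
  show ?thesis
    using keys_add[of a b]
    by (simp add: * lookup_add power_add prod.distrib)
qed

lemma evalp_eq_sum_mon: "evalp \<iota> \<sigma> f = (\<Sum>a \<in> Poly_Mapping.keys f. evalp \<iota> \<sigma> (mon a))"
  using arg_cong[OF pol_eq_sum_mon[of f], of "evalp \<iota> \<sigma>"] by (simp only: evalp_sum)

lemma evalp_mult: "evalp \<iota> \<sigma> (f * g) = evalp \<iota> \<sigma> f * evalp \<iota> \<sigma> g"
proof -
  have "f * g = (\<Sum>a \<in> Poly_Mapping.keys f. mon a) * (\<Sum>b \<in> Poly_Mapping.keys g. mon b)"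
    by (simp only: pol_eq_sum_mon[symmetric])
  also have "\<dots> = (\<Sum>a \<in> Poly_Mapping.keys f. \<Sum>b \<in> Poly_Mapping.keys g. mon (a + b))"
    by (simp add: sum_product mon_def mult_single)
  finally show ?thesis
    by (simp add: evalp_sum evalp_mon_add sum_product evalp_eq_sum_mon[of f] evalp_eq_sum_mon[of g])
qed

end

lemma evalp_var_id: "evalp (Poly_Mapping.single 0) var f = f"
proof -
  have pow: "var j ^ k = mon (Poly_Mapping.single j k)" for j k
    by (induction k) (simp_all add: var_def mon_def mult_single single_add[symmetric])
  have sum: "(\<Prod>j \<in> A. mon (g j)) = mon (\<Sum>j \<in> A. g j)" for A and g :: "nat \<Rightarrow> expo"
    by (induction A rule: infinite_finite_induct) (simp_all add: mon_def mult_single)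
  have exp: "(\<Sum>j \<in> Poly_Mapping.keys a. Poly_Mapping.single j (nu j a)) = a" for a :: expo
  proof (rule poly_mapping_eqI)
    fix k
    show "nu k (\<Sum>j \<in> Poly_Mapping.keys a. Poly_Mapping.single j (nu j a)) = nu k a"
      by (simp add: lookup_sum lookup_single when_def in_keys_iff)
  qed
  have "evalp (Poly_Mapping.single 0) var f = (\<Sum>a \<in> Poly_Mapping.keys f. mon a)"
    unfolding evalp_def by (intro sum.cong) (auto simp: pow sum exp in_keys_iff)
  then show ?thesis
    by (simp only: pol_eq_sum_mon[symmetric])
qed


section \<open>Steenrod squares\<close>

text \<open>
  The operations on \<open>pol\<close>; the action on \<open>P\<^sub>n\<close> is the restriction. The listed properties determine
  the operations, see \<open>steenrod_squares_exists\<close> and \<open>steenrod_squares_unique\<close> below.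
\<close>

definition steenrod_squares :: "(nat \<Rightarrow> pol \<Rightarrow> pol) \<Rightarrow> bool"
  where "steenrod_squares S \<longleftrightarrow>
    (\<forall>k. Vector_Spaces.linear scal scal (S k)) \<and>
    (\<forall>f. S 0 f = f) \<and>
    (\<forall>i. S 1 (var i) = var i ^ 2) \<and>
    (\<forall>i. \<forall>k > 1. S k (var i) = 0) \<and>
    (\<forall>k f g. S k (f * g) = (\<Sum>i \<le> k. S i f * S (k - i) g))"

definition Sq :: "nat \<Rightarrow> pol \<Rightarrow> pol"
  where "Sq = (THE S. steenrod_squares S)"

lemma linear_scal_iff:
  "Vector_Spaces.linear scal scal h \<longleftrightarrow> (\<forall>f g. h (f + g) = h f + h g)"
proof
  assume "Vector_Spaces.linear scal scal h"
  then show "\<forall>f g. h (f + g) = h f + h g"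
    by (simp add: Vector_Spaces.linear_iff)
next
  assume *: "\<forall>f g. h (f + g) = h f + h g"
  have "h 0 = 0"
    using *[rule_format, of 0 0] by simp
  then have "h (scal c f) = scal c (h f)" for c f
    by (cases c) simp_all
  with * show "Vector_Spaces.linear scal scal h"
    by (simp add: Vector_Spaces.linear_iff F2.vector_space_axioms)
qed

text \<open>
  Existence: \<open>S k f\<close> is the coefficient of \<open>t\<^sup>k\<close> in the image of \<open>f\<close> under \<open>x\<^sub>i \<mapsto> x\<^sub>i + x\<^sub>i\<^sup>2 t\<close>.
\<close>

lemma steenrod_squares_exists: "\<exists>S. steenrod_squares S"
proof -
  define c :: "bit \<Rightarrow> pol poly" where "c = (\<lambda>b. [:Poly_Mapping.single 0 b:])"
  define T where "T = evalp c (\<lambda>i. [:var i, var i ^ 2:])"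
  define T0 where "T0 = (\<lambda>f. coeff (T f) 0)"
  have c: "c 0 = 0" "c 1 = 1" "c (a + b) = c a + c b" for a b
    by (simp_all add: c_def single_add)
  have add: "T (f + g) = T f + T g" for f g
    unfolding T_def by (rule evalp_add) (fact c)+
  have mult: "T (f * g) = T f * T g" for f g
    unfolding T_def by (rule evalp_mult) (fact c)+
  have var: "T (var i) = [:var i, var i ^ 2:]" for i
    unfolding T_def by (rule evalp_var) (fact c)+
  have "coeff (T f) 0 = evalp (Poly_Mapping.single 0) var f" for f
    by (simp add: T_def evalp_def coeff_sum c_def poly_0_coeff_0[symmetric] poly_prod poly_sum)
  then have id: "coeff (T f) 0 = f" for f
    by (simp add: evalp_var_id)
  have "steenrod_squares (\<lambda>k f. coeff (T f) k)"
    unfolding steenrod_squares_def linear_scal_iff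
    by (auto simp: add id var mult coeff_mult coeff_pCons split: nat.split)
  then show ?thesis
    by blast
qed

lemma steenrod_squares_one:
  assumes "steenrod_squares S"
  shows "S k 1 = (if k = 0 then 1 else 0)"
proof (induction k rule: less_induct)
  case (less k)
  show ?case
  proof (cases "k = 0")
    case True
    then show ?thesis
      using assms by (simp add: steenrod_squares_def)
  next
    case False
    have "S k (1 * 1) = (\<Sum>i \<le> k. S i 1 * S (k - i) 1)"
      using assms unfolding steenrod_squares_def by blast
    also have "\<dots> = (\<Sum>i \<in> {0, k}. S i 1 * S (k - i) 1)"
      by (rule sum.mono_neutral_right) (auto simp: less)
    also have "\<dots> = S k 1 + S k 1"
      using False assms by (simp add: steenrod_squares_def)
    finally show ?thesis
      using False by simp
  qed
qed

lemma steenrod_squares_unique: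
  assumes S: "steenrod_squares S" and T: "steenrod_squares T"
  shows "S = T"
proof -
  define A where "A = {f. \<forall>k. S k f = T k f}"
  have one: "1 \<in> A"
    by (simp add: A_def steenrod_squares_one[OF S] steenrod_squares_one[OF T])
  have add: "f + g \<in> A" if "f \<in> A" "g \<in> A" for f g
    using that S T by (simp add: A_def steenrod_squares_def linear_scal_iff)
  have zero: "0 \<in> A"
    using add[OF one one] by simp
  have mult: "f * g \<in> A" if "f \<in> A" "g \<in> A" for f g
    using that S T by (simp add: A_def steenrod_squares_def)
  have var: "var i \<in> A" for i
  proof -
    have "S k (var i) = T k (var i)" for k
    proof -
      consider "k = 0" | "k = 1" | "k > 1" by linarith
      then show ?thesis
        by cases (use S T in \<open>simp_all add: steenrod_squares_def\<close>)
    qed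
    then show ?thesis
      by (simp add: A_def)
  qed
  have pow: "f ^ k \<in> A" if "f \<in> A" for f k
    by (induction k) (simp_all add: one mult that)
  have prod: "prod h B \<in> A" if "\<And>j. j \<in> B \<Longrightarrow> h j \<in> A" for h :: "nat \<Rightarrow> pol" and B
    using that by (induction B rule: infinite_finite_induct) (simp_all add: one mult)
  have sum: "sum h B \<in> A" if "\<And>j. j \<in> B \<Longrightarrow> h j \<in> A" for h :: "expo \<Rightarrow> pol" and B
    using that by (induction B rule: infinite_finite_induct) (simp_all add: zero add)
  have "evalp (Poly_Mapping.single 0) var f \<in> A" for f
    unfolding evalp_def by (auto intro!: sum prod pow var simp: in_keys_iff)
  then show ?thesis
    by (auto simp: evalp_var_id A_def fun_eq_iff)
qed

lemma steenrod_squares_Sq: "steenrod_squares Sq"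
  unfolding Sq_def using steenrod_squares_exists steenrod_squares_unique by (metis theI)


section \<open>Weight vectors and the relation \<open>\<simeq>\<close>\<close>

definition alpha :: "nat \<Rightarrow> nat \<Rightarrow> nat"
  where "alpha i a = a div 2 ^ i mod 2"

text \<open>
  A weight vector \<open>(\<omega>\<^sub>1, \<omega>\<^sub>2, \<dots>)\<close> is a function on \<open>nat\<close> whose value at \<open>0\<close> is never used.
\<close>

definition weight :: "expo \<Rightarrow> nat \<Rightarrow> nat"
  where "weight a i = (\<Sum>j \<in> Poly_Mapping.keys a. alpha (i - 1) (nu j a))"

definition weight_less :: "(nat \<Rightarrow> nat) \<Rightarrow> (nat \<Rightarrow> nat) \<Rightarrow> bool"
  where "weight_less v w \<longleftrightarrow> (\<exists>k \<ge> 1. v k < w k \<and> (\<forall>i \<in> {1..<k}. v i = w i))"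

definition deg_weight :: "(nat \<Rightarrow> nat) \<Rightarrow> nat"
  where "deg_weight w = (\<Sum>i \<in> {i. i > 0 \<and> w i \<noteq> 0}. 2 ^ (i - 1) * w i)"

definition P_minus :: "nat \<Rightarrow> (nat \<Rightarrow> nat) \<Rightarrow> pol set"
  where "P_minus n w = F2.span {mon a | a.
    mon a \<in> Pol n \<and> deg_expo a = deg_weight w \<and> weight_less (weight a) w}"

text \<open>
  \<open>\<A>\<^sub>s\<^sup>+\<close> is the span of the squares \<open>Sq\<^sup>j\<close> themselves, not the algebra they generate, so
  \<open>\<A>\<^sub>s\<^sup>+ P\<^sub>n\<close> is spanned by their values on \<open>P\<^sub>n\<close>.
\<close>

definition A_plus_P :: "nat \<Rightarrow> nat \<Rightarrow> pol set"
  where "A_plus_P s n = F2.span {Sq j f | j f. 1 \<le> j \<and> j < 2 ^ s \<and> f \<in> Pol n}"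

text \<open>
  The relation is only meant for elements of \<open>P\<^sub>n\<close> of the same degree; these conditions are part
  of its definition.
\<close>

definition simeq_weight :: "nat \<Rightarrow> nat \<Rightarrow> (nat \<Rightarrow> nat) \<Rightarrow> pol \<Rightarrow> pol \<Rightarrow> bool"
  where "simeq_weight n s w f g \<longleftrightarrow>
    f \<in> Pol n \<and> g \<in> Pol n \<and> (\<exists>d. homogeneous d f \<and> homogeneous d g) \<and>
    f - g \<in> {h + h' | h h'. h \<in> A_plus_P s n \<and> h' \<in> P_minus n w}"

text \<open>For a monomial \<open>x\<close>; the exponent vector \<open>a\<close> is determined by \<open>x\<close>.\<close>

definition simeq :: "nat \<Rightarrow> nat \<Rightarrow> pol \<Rightarrow> pol \<Rightarrow> bool"
  where "simeq n s x g \<longleftrightarrow> (\<exists>a. x = mon a \<and> simeq_weight n s (weight a) x g)"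


section \<open>The maps \<open>\<phi>\<close>\<close>

text \<open>
  A pair \<open>(i; I)\<close> is represented by a number and a list; the entry \<open>i\<^sub>t\<close> of \<open>I\<close> is \<open>I ! (t - 1)\<close>.
\<close>

definition Nset :: "nat \<Rightarrow> (nat \<times> nat list) set"
  where "Nset m = {(i, I). sorted_wrt (<) (i # I) \<and> set (i # I) \<subseteq> {1..m} \<and> length I < m}"

abbreviation entry :: "nat list \<Rightarrow> nat \<Rightarrow> nat"
  where "entry I t \<equiv> I ! (t - 1)"

definition insert_entry :: "nat list \<Rightarrow> nat \<Rightarrow> nat list"
  where "insert_entry I u = sorted_list_of_set (insert u (set I))"

lemma finite_Nset: "finite (Nset m)"
proof (rule finite_subset)
  show "Nset m \<subseteq> {1..m} \<times> {I. set I \<subseteq> {1..m} \<and> length I \<le> m}"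
    by (auto simp: Nset_def)
qed (simp add: finite_lists_length_le)

text \<open>The algebra homomorphism \<open>f\<^sub>i\<close>.\<close>

definition f_hom :: "nat \<Rightarrow> pol \<Rightarrow> pol"
  where "f_hom i = evalp (Poly_Mapping.single 0) (\<lambda>j. if j < i then var j else var (j + 1))"

definition compatible :: "nat list \<Rightarrow> nat \<Rightarrow> expo \<Rightarrow> bool"
  where "compatible I u a \<longleftrightarrow> (let r = length I in
    1 \<le> u \<and> u \<le> r \<and>
    (\<forall>t \<in> {1..<u}. nu (entry I t - 1) a = 2 ^ r - 1) \<and>
    nu (entry I u - 1) a > 2 ^ r - 1 \<and>
    (\<forall>t \<in> {1..u}. alpha (r - t) (nu (entry I u - 1) a) = 1) \<and>
    (\<forall>t \<in> {u<..r}. alpha (r - t) (nu (entry I t - 1) a) = 1))"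

definition x_sub :: "nat list \<Rightarrow> nat \<Rightarrow> pol"
  where "x_sub I u = (let r = length I in
    var (entry I u) ^ (\<Sum>t \<in> {1..u}. 2 ^ (r - t)) *
    (\<Prod>t \<in> {u<..r}. var (entry I t) ^ (2 ^ (r - t))))"

definition exact_quotient :: "pol \<Rightarrow> pol \<Rightarrow> pol"
  where "exact_quotient p q = (THE h. p = h * q)"

definition phi_mon :: "nat \<Rightarrow> nat list \<Rightarrow> expo \<Rightarrow> pol"
  where "phi_mon i I a =
    (if \<exists>u. compatible I u a
     then exact_quotient (var i ^ (2 ^ length I - 1) * f_hom i (mon a))
            (x_sub I (THE u. compatible I u a))
     else 0)"

definition phi :: "nat \<Rightarrow> nat list \<Rightarrow> pol \<Rightarrow> pol"
  where "phi i I p =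
    (if I = [] then f_hom i p
     else \<Sum>a \<in> Poly_Mapping.keys p. scal (Poly_Mapping.lookup p a) (phi_mon i I a))"

text \<open>The unique choice of \<open>u\<close> and the quotient in \<open>phi_mon\<close> exist.\<close>

lemma compatible_unique:
  assumes "compatible I u a" "compatible I v a"
  shows "u = v"
proof -
  have "\<not> u < v" if "compatible I u a" "compatible I v a" for u v
    using that by (fastforce simp: compatible_def Let_def)
  with assms show ?thesis
    by (meson linorder_neqE_nat)
qed

lemma exact_quotient_mult:
  assumes "q \<noteq> 0"
  shows "exact_quotient (h * q) q = h"
  unfolding exact_quotient_def using assms by (intro the_equality) auto

lemma x_sub_nonzero: "x_sub I u \<noteq> 0"
proof -
  have "var j \<noteq> 0" for j
    unfolding var_def mon_def by (metis lookup_single_eq lookup_zero zero_neq_one)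
  then show ?thesis
    by (simp add: x_sub_def Let_def)
qed

lemma x_sub_dvd:
  assumes N: "sorted_wrt (<) (i # I)" and comp: "compatible I u a"
  shows "x_sub I u dvd f_hom i (mon a)"
proof -
  define r where "r = length I"
  define e where "e t = (if t = u then \<Sum>t \<in> {1..u}. 2 ^ (r - t) else 2 ^ (r - t) :: nat)" for t
  have u: "1 \<le> u" "u \<le> r"
    using comp by (auto simp: compatible_def r_def Let_def)
  have sub: "x_sub I u = (\<Prod>t \<in> {u..r}. var (entry I t) ^ e t)"
  proof -
    have "{u..r} = insert u {u<..r}"
      using u by auto
    then show ?thesis
      by (simp add: x_sub_def e_def r_def Let_def)
  qed
  have gt: "i < entry I t" if "t \<in> {u..r}" for t
    using N that u by (auto simp: r_def)
  have le: "e t \<le> nu (entry I t - 1) a" if t: "t \<in> {u..r}" for t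
  proof (cases "t = u")
    case True
    have "(\<Sum>t \<in> {1..u}. 2 ^ (r - t)) \<le> (\<Sum>t \<in> {1..r}. 2 ^ (r - t) :: nat)"
      using u by (intro sum_mono2) auto
    also have "\<dots> = (\<Sum>t < r. 2 ^ t)"
      by (rule sum.reindex_bij_witness[of _ "\<lambda>t. r - t" "\<lambda>t. r - t"]) auto
    also have "\<dots> = 2 ^ r - 1"
      by (simp add: lessThan_atLeast0 sum_power2)
    also have "\<dots> < nu (entry I u - 1) a"
      using comp by (simp add: compatible_def r_def Let_def)
    finally show ?thesis
      using True by (simp add: e_def)
  next
    case False
    then have "alpha (r - t) (nu (entry I t - 1) a) = 1"
      using comp t by (simp add: compatible_def r_def Let_def)
    then have "2 ^ (r - t) \<le> nu (entry I t - 1) a"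
      unfolding alpha_def by (metis div_less linorder_not_less mod_0 zero_neq_one)
    then show ?thesis
      using False by (simp add: e_def)
  qed
  have pos: "e t > 0" for t
    using u by (auto simp: e_def intro!: sum_pos)
  define s where "s j = (if j < i then var j else var (j + 1))" for j
  have fm: "f_hom i (mon a) = (\<Prod>j \<in> Poly_Mapping.keys a. s j ^ nu j a)"
    by (simp add: f_hom_def evalp_mon s_def single_add)
  have inj: "inj_on (\<lambda>t. entry I t - 1) {u..r}"
  proof (rule strict_mono_on_imp_inj_on, rule strict_mono_onI)
    fix t t' assume *: "t \<in> {u..r}" "t' \<in> {u..r}" "t < t'"
    then have "entry I t < entry I t'"
      using N u by (auto simp: r_def intro!: sorted_wrt_nth_less[of "(<)" I])
    with gt[OF *(1)] show "entry I t - 1 < entry I t' - 1"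
      by simp
  qed
  have "x_sub I u dvd (\<Prod>t \<in> {u..r}. s (entry I t - 1) ^ nu (entry I t - 1) a)"
    unfolding sub
  proof (rule prod_dvd_prod)
    fix t assume t: "t \<in> {u..r}"
    have "s (entry I t - 1) = var (entry I t)"
    proof -
      have "\<not> entry I t - 1 < i" "entry I t - 1 + 1 = entry I t"
        using gt[OF t] by linarith+
      then show ?thesis
        by (simp only: s_def if_False)
    qed
    then show "var (entry I t) ^ e t dvd s (entry I t - 1) ^ nu (entry I t - 1) a"
      using le[OF t] by (simp add: le_imp_power_dvd)
  qed
  also have "\<dots> = (\<Prod>j \<in> (\<lambda>t. entry I t - 1) ` {u..r}. s j ^ nu j a)"
    by (simp only: prod.reindex[OF inj] o_def)
  also have "\<dots> dvd f_hom i (mon a)"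
    unfolding fm
  proof (rule prod_dvd_prod_subset)
    show "(\<lambda>t. entry I t - 1) ` {u..r} \<subseteq> Poly_Mapping.keys a"
    proof (rule image_subsetI)
      fix t assume "t \<in> {u..r}"
      then have "nu (entry I t - 1) a \<noteq> 0"
        using le[of t] pos[of t] by linarith
      then show "entry I t - 1 \<in> Poly_Mapping.keys a"
        by (simp only: in_keys_iff not_False_eq_True)
    qed
  qed simp
  finally show ?thesis .
qed

lemma phi_mon_mult:
  assumes "sorted_wrt (<) (i # I)" "compatible I u a"
  shows "phi_mon i I a * x_sub I u = var i ^ (2 ^ length I - 1) * f_hom i (mon a)"
proof -
  have "(THE u. compatible I u a) = u"
    using assms(2) compatible_unique by blast
  then have phi: "phi_mon i I a
      = exact_quotient (var i ^ (2 ^ length I - 1) * f_hom i (mon a)) (x_sub I u)"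
    using assms(2) unfolding phi_mon_def by metis
  obtain h where h: "f_hom i (mon a) = x_sub I u * h"
    using x_sub_dvd[OF assms] by (rule dvdE)
  then have eq: "var i ^ (2 ^ length I - 1) * f_hom i (mon a)
      = var i ^ (2 ^ length I - 1) * h * x_sub I u"
    by (simp only: mult.assoc mult.commute[of h])
  show ?thesis
    unfolding phi unfolding eq by (simp only: exact_quotient_mult[OF x_sub_nonzero])
qed


section \<open>Products of variables\<close>

text \<open>The product \<open>X = x\<^sub>1 \<cdots> x\<^bsub>n-1\<^esub>\<close> in \<open>P\<^bsub>n-1\<^esub>\<close>.\<close>

definition X_all :: "nat \<Rightarrow> pol"
  where "X_all n = (\<Prod>m \<in> {1..n - 1}. var m)"

text \<open>The product \<open>X\<^sub>j\<close> in \<open>P\<^sub>n\<close>.\<close>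

definition X_omit :: "nat \<Rightarrow> nat \<Rightarrow> pol"
  where "X_omit n j = (\<Prod>m \<in> {1..n} - {j}. var m)"

end

theory Submission
  imports Defs "HOL-Library.Multiset"
begin

text \<open>
  Every monomial involved has the form \<open>X\<^bsub>v\<^sub>0\<^esub> X\<^bsub>v\<^sub>1\<^esub>\<^sup>2 X\<^bsub>v\<^sub>2\<^esub>\<^sup>4 \<cdots> y\<^sup>N\<close> with \<open>N = 2\<^sup>l\<close>, for a word
  \<open>v\<close> of length \<open>l\<close>; in particular \<open>\<phi>\<^bsub>(i;I)\<^esub>(X\<^sup>N\<^sup>-\<^sup>1) y\<^sup>N\<close> is given by the reversal of \<open>I\<close> followed by
  letters \<open>i\<close>. The map \<open>h \<mapsto> X\<^sub>a h\<^sup>2\<close> carries the relation at level \<open>s\<close> to level \<open>s + 1\<close>, because a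
  positive square applied to \<open>X\<^sub>a\<close> lowers the first weight. With \<open>P = x\<^sub>1 \<cdots> x\<^sub>n\<close> all relations come
  from \<open>Sq\<^sup>1(P q\<^sup>2) = \<Sum>\<^sub>u X\<^sub>u (x\<^sub>u q)\<^sup>2\<close>. Suitable \<open>q\<close> give \<open>ab \<sim> ba\<close> and \<open>aab \<sim> bba\<close>, so that modulo
  hits a word matters only through its set \<open>S\<close> of letters; write \<open>[S | y]\<close> for its class. The choice
  \<open>q = 1\<close> (or \<open>q\<close> a power of \<open>P\<close>, if \<open>S\<close> is empty) gives \<open>\<Sum>\<^sub>u [S \<union> u | x\<^sub>u] \<sim> 0\<close> for \<open>\<bar>S\<bar> < l\<close>. Summing over \<open>S \<subseteq> {1, \<dots>, l - 1}\<close>, the terms with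
  \<open>u < l\<close> cancel in pairs and the remaining ones form the asserted relation.
\<close>

section \<open>Properties of the Steenrod squares\<close>

lemma Sq_add: "Sq k (f + g) = Sq k f + Sq k g"
  using steenrod_squares_Sq by (simp add: steenrod_squares_def linear_scal_iff)

lemma Sq_0 [simp]: "Sq 0 f = f"
  using steenrod_squares_Sq by (simp add: steenrod_squares_def)

lemma Sq_var: "Sq k (var i) = (if k = 0 then var i else if k = 1 then var i ^ 2 else 0)"
proof -
  consider "k = 0" | "k = 1" | "k > 1"
    by linarith
  then show ?thesis
    by cases (use steenrod_squares_Sq in \<open>simp_all add: steenrod_squares_def\<close>)
qed

lemma Sq_mult: "Sq k (f * g) = (\<Sum>i\<le>k. Sq i f * Sq (k - i) g)"
  using steenrod_squares_Sq unfolding steenrod_squares_def by blast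

lemma Sq_zero [simp]: "Sq k 0 = 0"
  using Sq_add[of k 0 0] by simp

lemma Sq_sum: "Sq k (sum f A) = (\<Sum>i\<in>A. Sq k (f i))"
  by (induction A rule: infinite_finite_induct) (simp_all add: Sq_add)

lemma Sq_one: "Sq k 1 = (if k = 0 then 1 else 0)"
  by (rule steenrod_squares_one[OF steenrod_squares_Sq])

lemma pol_power2_add: "(f + g) ^ 2 = f ^ 2 + (g ^ 2 :: pol)"
proof -
  have "(2 :: pol) = 0"
    by (metis one_add_one pol_add_self)
  then show ?thesis
    by (simp add: power2_sum)
qed

lemma pol_power2_sum: "(sum f A) ^ 2 = (\<Sum>i\<in>A. f i ^ 2 :: pol)"
  by (induction A rule: infinite_finite_induct) (simp_all add: pol_power2_add)

lemma pol_minus: "f - g = f + (g :: pol)"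
  using pol_add_self[of g] by (simp add: diff_eq_eq add.assoc)

text \<open>In the Cartan formula for \<open>f * f\<close> the terms \<open>i\<close> and \<open>k - i\<close> cancel.\<close>

lemma Sq_power2: "Sq k (f ^ 2) = (if even k then Sq (k div 2) f ^ 2 else 0)"
proof -
  let ?t = "\<lambda>i. Sq i f * Sq (k - i) f"
  have *: "{..k} = {i. 2 * i < k} \<union> ({i. i \<le> k \<and> k < 2 * i} \<union> {i. k = 2 * i})"
    by auto
  have fin: "finite {i. 2 * i < k}" "finite {i. i \<le> k \<and> k < 2 * i}" "finite {i. k = 2 * i}"
    by (rule finite_subset[of _ "{..k}"]; auto)+
  have "sum ?t {i. 2 * i < k} = sum ?t {i. i \<le> k \<and> k < 2 * i}"
    by (rule sum.reindex_bij_witness[of _ "\<lambda>i. k - i" "\<lambda>i. k - i"]) (auto simp: mult.commute)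
  moreover have "sum ?t {..k} = sum ?t {i. 2 * i < k} + (sum ?t {i. i \<le> k \<and> k < 2 * i} + sum ?t {i. k = 2 * i})"
    unfolding * using fin by (subst sum.union_disjoint; (subst sum.union_disjoint)?; auto)
  ultimately have "Sq k (f ^ 2) = sum ?t {i. k = 2 * i}"
    by (simp add: power2_eq_square Sq_mult add.assoc[symmetric])
  also have "\<dots> = (if even k then Sq (k div 2) f ^ 2 else 0)"
  proof (cases "even k")
    case True
    then obtain m where k: "k = 2 * m" ..
    then have "{i. k = 2 * i} = {m}" by auto
    then show ?thesis
      using k by (simp add: power2_eq_square mult_2)
  next
    case False
    then have "{i. k = 2 * i} = {}" by auto
    then show ?thesis
      using False by simp
  qed
  finally show ?thesis .
qed

section \<open>Monomials as products of variables\<close>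

lemma mon_mult: "mon a * mon b = mon (a + b)"
  by (simp add: mon_def mult_single)

lemma mon_zero: "mon 0 = 1"
  by (simp add: mon_def)

lemma mon_power2: "mon a ^ 2 = mon (a + a)"
  by (simp add: power2_eq_square mon_mult)

lemma mon_eq_prod: "mon a = (\<Prod>j\<in>Poly_Mapping.keys a. var j ^ nu j a)"
proof -
  have "mon a = evalp (Poly_Mapping.single 0) var (mon a)"
    by (simp add: evalp_var_id)
  also have "\<dots> = (\<Prod>j\<in>Poly_Mapping.keys a. var j ^ nu j a)"
    by (rule evalp_mon) (simp_all add: single_add)
  finally show ?thesis .
qed

section \<open>The grading\<close>

lemma keys_expo_add: "Poly_Mapping.keys (a + b) = Poly_Mapping.keys a \<union> Poly_Mapping.keys (b :: expo)"
  by (auto simp: in_keys_iff lookup_add)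

lemma keys_mon [simp]: "Poly_Mapping.keys (mon a) = {a}"
  by (simp add: mon_def)

lemma mon_in_Pol: "mon a \<in> Pol n \<longleftrightarrow> Poly_Mapping.keys a \<subseteq> {1..n}"
  by (simp add: Pol_def)

lemma var_in_Pol: "j \<in> {1..n} \<Longrightarrow> var j \<in> Pol n"
  by (simp add: var_def mon_in_Pol)

lemma one_in_Pol: "1 \<in> Pol n"
  by (simp add: mon_zero[symmetric] mon_in_Pol)

lemma Pol_add: "f \<in> Pol n \<Longrightarrow> g \<in> Pol n \<Longrightarrow> f + g \<in> Pol n"
  unfolding Pol_def using keys_add[of f g] by blast

lemma Pol_mult: "f \<in> Pol n \<Longrightarrow> g \<in> Pol n \<Longrightarrow> f * g \<in> Pol n"
  unfolding Pol_def using keys_mult[of f g] by (fastforce simp: keys_expo_add)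

lemma Pol_power: "f \<in> Pol n \<Longrightarrow> f ^ k \<in> Pol n"
  by (induction k) (simp_all add: one_in_Pol Pol_mult)

lemma Pol_prod: "(\<And>i. i \<in> A \<Longrightarrow> f i \<in> Pol n) \<Longrightarrow> prod f A \<in> Pol n"
  by (induction A rule: infinite_finite_induct) (simp_all add: one_in_Pol Pol_mult)

lemma Pol_sum: "(\<And>i. i \<in> A \<Longrightarrow> f i \<in> Pol n) \<Longrightarrow> sum f A \<in> Pol n"
  by (induction A rule: infinite_finite_induct) (simp_all add: Pol_add, simp_all add: Pol_def)

lemma deg_expo_add: "deg_expo (a + b) = deg_expo a + deg_expo b"
proof -
  have *: "deg_expo c = (\<Sum>j\<in>Poly_Mapping.keys a \<union> Poly_Mapping.keys b. nu j c)"
    if "Poly_Mapping.keys c \<subseteq> Poly_Mapping.keys a \<union> Poly_Mapping.keys b" for c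
    unfolding deg_expo_def using that by (intro sum.mono_neutral_left) (auto simp: in_keys_iff)
  show ?thesis
    by (simp add: * keys_expo_add lookup_add sum.distrib)
qed

lemma homogeneous_0 [simp]: "homogeneous d 0"
  by (simp add: homogeneous_def)

lemma homogeneous_mon: "homogeneous d (mon a) \<longleftrightarrow> deg_expo a = d"
  by (simp add: homogeneous_def)

lemma homogeneous_var: "homogeneous 1 (var j)"
  by (simp add: var_def homogeneous_mon deg_expo_def)

lemma homogeneous_one: "homogeneous 0 1"
  by (simp add: mon_zero[symmetric] homogeneous_mon deg_expo_def)

lemma homogeneous_add: "homogeneous d f \<Longrightarrow> homogeneous d g \<Longrightarrow> homogeneous d (f + g)"
  unfolding homogeneous_def using keys_add[of f g] by blast

lemma homogeneous_sum: "(\<And>i. i \<in> A \<Longrightarrow> homogeneous d (f i)) \<Longrightarrow> homogeneous d (sum f A)"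
  by (induction A rule: infinite_finite_induct) (simp_all add: homogeneous_add)

lemma homogeneous_mult: "homogeneous d f \<Longrightarrow> homogeneous e g \<Longrightarrow> homogeneous (d + e) (f * g)"
  unfolding homogeneous_def using keys_mult[of f g] by (fastforce simp: deg_expo_add)

lemma homogeneous_prod_var:
  "finite A \<Longrightarrow> homogeneous (card A) (\<Prod>m\<in>A. var m)"
proof (induction A rule: finite_induct)
  case (insert x F)
  then show ?case
    using homogeneous_mult[OF homogeneous_var[of x] insert.IH] by simp
qed (simp add: homogeneous_one)

text \<open>The two indices in each term of the Cartan formula add up to \<open>j\<close>.\<close>

lemma homogeneous_Sq_mult:
  assumes "\<And>j. homogeneous (d + j) (Sq j f)" "\<And>j. homogeneous (e + j) (Sq j g)"
  shows "homogeneous (d + e + j) (Sq j (f * g))"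
  unfolding Sq_mult
proof (rule homogeneous_sum)
  fix i assume "i \<in> {..j}"
  then show "homogeneous (d + e + j) (Sq i f * Sq (j - i) g)"
    using homogeneous_mult[OF assms(1)[of i] assms(2)[of "j - i"]] by (simp add: algebra_simps)
qed

text \<open>Makes the generators of \<open>hits\<close> homogeneous, so that a single degree can be
  projected out.\<close>

lemma homogeneous_Sq_mon: "homogeneous (deg_expo a + j) (Sq j (mon a))"
proof -
  have one: "homogeneous (0 + j) (Sq j 1)" for j
    by (simp add: Sq_one homogeneous_one)
  have var: "homogeneous (1 + j) (Sq j (var m))" for j m
    using homogeneous_var[of m] homogeneous_mult[OF homogeneous_var[of m] homogeneous_var[of m]]
    by (auto simp: Sq_var power2_eq_square)
  have pow: "homogeneous (k + j) (Sq j (var m ^ k))" for j k m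
  proof (induction k arbitrary: j)
    case (Suc k)
    have "homogeneous (1 + k + j) (Sq j (var m * var m ^ k))"
      by (rule homogeneous_Sq_mult[OF var Suc.IH])
    then show ?case
      by simp
  qed (use one in simp)
  \<comment> \<open>Generalised from \<open>keys a\<close> to any finite set, so that the induction
    can split off one variable.\<close>
  have "homogeneous (sum g A + j) (Sq j (\<Prod>m\<in>A. var m ^ g m))"
    if "finite A" for A and g :: "nat \<Rightarrow> nat"
    using that
  proof (induction A arbitrary: j rule: finite_induct)
    case (insert x F)
    have "homogeneous (g x + sum g F + j) (Sq j (var x ^ g x * (\<Prod>m\<in>F. var m ^ g m)))"
      by (rule homogeneous_Sq_mult[OF pow insert.IH])
    with insert show ?case
      by simp
  qed (use one in simp)
  then show ?thesis
    by (simp add: mon_eq_prod deg_expo_def)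
qed

text \<open>The homogeneous component; every coefficient that occurs is 1.\<close>

definition deg_part :: "nat \<Rightarrow> pol \<Rightarrow> pol"
  where "deg_part d f = (\<Sum>a\<in>{a \<in> Poly_Mapping.keys f. deg_expo a = d}. mon a)"

lemma lookup_deg_part:
  "Poly_Mapping.lookup (deg_part d f) a = (if deg_expo a = d then Poly_Mapping.lookup f a else 0)"
proof -
  have "Poly_Mapping.lookup (deg_part d f) a
      = (\<Sum>b\<in>{b \<in> Poly_Mapping.keys f. deg_expo b = d}. if b = a then 1 else 0)"
    by (auto simp: deg_part_def lookup_sum mon_def lookup_single when_def intro!: sum.cong)
  also have "\<dots> = (if deg_expo a = d then Poly_Mapping.lookup f a else 0)"
  proof (subst sum.delta)
    show "finite {b \<in> Poly_Mapping.keys f. deg_expo b = d}"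
      by (rule finite_subset[of _ "Poly_Mapping.keys f"]) auto
  qed (auto simp: in_keys_iff)
  finally show ?thesis .
qed

lemma deg_part_add: "deg_part d (f + g) = deg_part d f + deg_part d g"
  by (rule poly_mapping_eqI) (simp add: lookup_deg_part lookup_add)

lemma deg_part_homogeneous: "homogeneous e f \<Longrightarrow> deg_part d f = (if e = d then f else 0)"
  by (rule poly_mapping_eqI)
    (auto simp: lookup_deg_part homogeneous_def in_keys_iff simp del: bit_not_zero_iff)

text \<open>Projection to degree \<open>d\<close> is linear, fixes \<open>h\<close> and sends each
  generator to itself or to 0.\<close>

lemma homogeneous_in_span:
  assumes h: "homogeneous d h" "h \<in> F2.span G"
    and G: "\<And>g. g \<in> G \<Longrightarrow> \<exists>e. homogeneous e g"
  shows "h \<in> F2.span {g \<in> G. homogeneous d g}"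
proof -
  have "deg_part d f \<in> F2.span {g \<in> G. homogeneous d g}" if "f \<in> F2.span G" for f
    using that
  proof (induction rule: F2.span_induct_alt)
    case base
    have "deg_part d 0 = 0"
      using deg_part_add[of d 0 0] by simp
    then show ?case
      by (simp add: F2.span_zero)
  next
    case (step c x y)
    obtain e where e: "homogeneous e x"
      using G step(1) by blast
    have "deg_part d x \<in> F2.span {g \<in> G. homogeneous d g}"
      using e step(1) by (auto simp: deg_part_homogeneous F2.span_zero intro!: F2.span_base)
    then show ?case
      using step by (cases c) (simp_all add: deg_part_add F2.span_add)
  qed
  from this[OF h(2)] show ?thesis
    using h(1) by (simp add: deg_part_homogeneous)
qed

section \<open>Polynomials of low weight\<close>

definition sqfree :: "nat set \<Rightarrow> expo"
  where "sqfree B = (\<Sum>m\<in>B. Poly_Mapping.single m 1)"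

lemma prod_var_eq_mon: "(\<Prod>m\<in>B. var m) = mon (sqfree B)"
  by (induction B rule: infinite_finite_induct)
    (simp_all add: sqfree_def mon_zero var_def mon_mult)

lemma nu_sqfree: "finite B \<Longrightarrow> nu j (sqfree B) = (if j \<in> B then 1 else 0)"
  by (simp add: sqfree_def lookup_sum lookup_single when_def)

lemma keys_sqfree: "finite B \<Longrightarrow> Poly_Mapping.keys (sqfree B) = B"
  by (auto simp: in_keys_iff nu_sqfree split: if_splits)

section \<open>Weights of squarefree monomials times squares\<close>

lemma alpha_0 [simp]: "alpha i 0 = 0"
  by (simp add: alpha_def)

lemma weight_superset:
  "finite A \<Longrightarrow> Poly_Mapping.keys a \<subseteq> A \<Longrightarrow> weight a i = (\<Sum>j\<in>A. alpha (i - 1) (nu j a))"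
  unfolding weight_def by (intro sum.mono_neutral_left) (auto simp: in_keys_iff)

text \<open>Doubling an exponent shifts its binary digits by one place, and the squarefree part
  fills the lowest digit.\<close>

lemma weight_sqfree_mult_square:
  assumes "finite B"
  shows "weight (sqfree B + (b + b)) 1 = card B"
    and "i \<ge> 1 \<Longrightarrow> weight (sqfree B + (b + b)) (Suc i) = weight b i"
proof -
  let ?a = "sqfree B + (b + b)" and ?A = "B \<union> Poly_Mapping.keys b"
  have w: "weight c i = (\<Sum>j\<in>?A. alpha (i - 1) (nu j c))" if "Poly_Mapping.keys c \<subseteq> ?A" for c i
    by (rule weight_superset) (use assms that in auto)
  have ka: "Poly_Mapping.keys ?a \<subseteq> ?A"
    by (auto simp: keys_expo_add keys_sqfree assms)
  have nu: "nu j ?a = (if j \<in> B then 1 else 0) + 2 * nu j b" for j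
    by (simp add: lookup_add nu_sqfree assms)
  have "alpha 0 (nu j ?a) = (if j \<in> B then 1 else 0)" for j
    by (auto simp: nu alpha_def)
  then have "weight ?a 1 = (\<Sum>j\<in>?A. if j \<in> B then 1 else 0)"
    by (simp add: w[OF ka])
  also have "\<dots> = (\<Sum>j\<in>B. 1)"
    using assms by (intro sum.mono_neutral_cong_right) auto
  finally show "weight ?a 1 = card B"
    by simp
  assume "i \<ge> 1"
  then obtain k where i: "i = Suc k"
    by (cases i) auto
  have "alpha (Suc k) (nu j ?a) = alpha k (nu j b)" for j
    unfolding nu alpha_def by (simp add: div_mult2_eq)
  then show "weight ?a (Suc i) = weight b i"
    by (simp add: w[OF ka] w[of b] i)
qed

text \<open>The entries \<open>n - 1\<close> are the first \<open>k\<close> weights of X_l^(2^k - 1)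
  x_l^(2^k). Beyond \<open>k\<close> the bound is 0, so the strict drop has to occur among the first
  \<open>k\<close> weights.\<close>

definition low_weight :: "nat \<Rightarrow> nat \<Rightarrow> expo \<Rightarrow> bool"
  where "low_weight n k b \<longleftrightarrow> weight_less (weight b) (\<lambda>i. if i \<le> k then n - 1 else 0)"

lemma low_weight_mono: "low_weight n k b \<Longrightarrow> k \<le> k' \<Longrightarrow> low_weight n k' b"
  unfolding low_weight_def weight_less_def
  by (elim exE conjE, rename_tac j, rule_tac x=j in exI) (auto split: if_splits)

text \<open>The weights move up by one place behind a new first entry \<open>n - 1\<close>, which
  agrees with the bound; the drop moves from \<open>j\<close> to \<open>Suc j\<close>.\<close>

lemma low_weight_square:
  assumes "low_weight n k b" "finite B" "card B = n - 1"
  shows "low_weight n (Suc k) (sqfree B + (b + b))"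
proof -
  obtain j where j: "j \<ge> 1" "weight b j < (if j \<le> k then n - 1 else 0)"
    "\<forall>i\<in>{1..<j}. weight b i = (if i \<le> k then n - 1 else 0)"
    using assms(1) unfolding low_weight_def weight_less_def by blast
  note w = weight_sqfree_mult_square[OF assms(2), where b = b]
  have "weight (sqfree B + (b + b)) i = (if i \<le> Suc k then n - 1 else 0)" if "i \<in> {1..<Suc j}" for i
  proof (cases "i = 1")
    case True
    then show ?thesis
      using w(1) assms(3) by simp
  next
    case False
    then have "i = Suc (i - 1)" "i - 1 \<in> {1..<j}"
      using that by auto
    then show ?thesis
      using w(2)[of "i - 1"] j(3) by simp
  qed
  then show ?thesis
    unfolding low_weight_def weight_less_def using j(1,2) w(2)[of j]
    by (intro exI[of _ "Suc j"]) simp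
qed

lemma low_weight_1: "finite B \<Longrightarrow> card B < n - 1 \<Longrightarrow> low_weight n 1 (sqfree B + (b + b))"
  unfolding low_weight_def weight_less_def
  by (intro exI[of _ 1]) (use weight_sqfree_mult_square(1)[where B = B and b = b] in auto)

section \<open>Elements of low weight and hit elements\<close>

definition Low :: "nat \<Rightarrow> nat \<Rightarrow> pol set"
  where "Low n k = F2.span {mon b | b. Poly_Mapping.keys b \<subseteq> {1..n} \<and> low_weight n k b}"

text \<open>
  No degree condition is imposed here; projecting to one degree at the end turns the second set of
  generators into those of \<open>P_minus\<close>, see \<open>hits_homogeneous\<close>.
\<close>

definition hits :: "nat \<Rightarrow> nat \<Rightarrow> nat \<Rightarrow> pol set"
  where "hits n s k = F2.span
    ({Sq j (mon b) | j b. 1 \<le> j \<and> j < 2 ^ s \<and> Poly_Mapping.keys b \<subseteq> {1..n}} \<union>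
     {mon b | b. Poly_Mapping.keys b \<subseteq> {1..n} \<and> low_weight n k b})"

lemma Low_subset_hits: "Low n k \<subseteq> hits n s k"
  unfolding Low_def hits_def by (rule F2.span_mono) blast

lemma hits_mono: "s \<le> s' \<Longrightarrow> k \<le> k' \<Longrightarrow> hits n s k \<subseteq> hits n s' k'"
proof -
  assume s: "s \<le> s'" and k: "k \<le> k'"
  have "j < 2 ^ s'" if "j < 2 ^ s" for j :: nat
    using that power_increasing[OF s, of "2 :: nat"] by linarith
  then show ?thesis
    unfolding hits_def using low_weight_mono[OF _ k]
    by (intro F2.span_mono Un_mono) blast+
qed

lemma hits_0 [simp]: "0 \<in> hits n s k"
  by (simp add: hits_def F2.span_zero)

lemma hits_add: "f \<in> hits n s k \<Longrightarrow> g \<in> hits n s k \<Longrightarrow> f + g \<in> hits n s k"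
  by (simp add: hits_def F2.span_add)

lemma hits_sum: "(\<And>i. i \<in> A \<Longrightarrow> f i \<in> hits n s k) \<Longrightarrow> sum f A \<in> hits n s k"
  by (simp add: hits_def F2.span_sum)

lemma Sq_in_hits:
  assumes "1 \<le> j" "j < 2 ^ s" "f \<in> Pol n"
  shows "Sq j f \<in> hits n s k"
proof -
  have "Sq j f = (\<Sum>a\<in>Poly_Mapping.keys f. Sq j (mon a))"
    using arg_cong[OF pol_eq_sum_mon[of f], of "Sq j"] by (simp only: Sq_sum)
  also have "\<dots> \<in> hits n s k"
    unfolding hits_def
    by (intro F2.span_sum F2.span_base UnI1) (use assms in \<open>auto simp: Pol_def\<close>)
  finally show ?thesis .
qed

text \<open>Squaring is additive, so the product is a sum of monomials with first weight
  \<open>card B\<close>.\<close>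

lemma prod_var_mult_square_in_Low:
  assumes "B \<subseteq> {1..n}" "card B < n - 1" "g \<in> Pol n"
  shows "(\<Prod>m\<in>B. var m) * g ^ 2 \<in> Low n 1"
proof -
  have fin: "finite B"
    using assms(1) finite_subset by blast
  have "(\<Prod>m\<in>B. var m) * g ^ 2 = (\<Prod>m\<in>B. var m) * (\<Sum>b\<in>Poly_Mapping.keys g. mon b) ^ 2"
    by (simp only: pol_eq_sum_mon[symmetric])
  also have "\<dots> = (\<Sum>b\<in>Poly_Mapping.keys g. mon (sqfree B + (b + b)))"
    by (simp only: pol_power2_sum sum_distrib_left mon_power2 mon_mult prod_var_eq_mon)
  also have "\<dots> \<in> Low n 1"
    unfolding Low_def
  proof (intro F2.span_sum F2.span_base CollectI exI conjI refl)
    fix b assume "b \<in> Poly_Mapping.keys g"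
    then show "Poly_Mapping.keys (sqfree B + (b + b)) \<subseteq> {1..n}"
      using assms(1,3) by (auto simp: keys_expo_add keys_sqfree fin Pol_def)
    show "low_weight n 1 (sqfree B + (b + b))"
      by (rule low_weight_1) (fact fin assms(2))+
  qed (rule refl)
  finally show ?thesis .
qed

lemma X_omit_in_Pol: "X_omit n a \<in> Pol n"
  unfolding X_omit_def by (rule Pol_prod) (auto intro: var_in_Pol)

lemma X_omit_eq_mon: "X_omit n a = mon (sqfree ({1..n} - {a}))"
  by (simp add: X_omit_def prod_var_eq_mon)

lemma X_omit_mon_square_in_Low:
  assumes "a \<in> {1..n}" "Poly_Mapping.keys b \<subseteq> {1..n}" "low_weight n k b"
  shows "X_omit n a * mon b ^ 2 \<in> Low n (Suc k)"
proof -
  have "low_weight n (Suc k) (sqfree ({1..n} - {a}) + (b + b))"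
    by (rule low_weight_square) (use assms in auto)
  moreover have "Poly_Mapping.keys (sqfree ({1..n} - {a}) + (b + b)) \<subseteq> {1..n}"
    using assms by (auto simp: keys_expo_add keys_sqfree)
  ultimately show ?thesis
    unfolding Low_def X_omit_eq_mon mon_power2 mon_mult by (blast intro: F2.span_base)
qed

text \<open>Each application of \<open>Sq\<^sup>1\<close> to a variable removes it from the squarefree part.\<close>

lemma Sq_prod_var_mult_square_in_Low:
  assumes "finite A" "finite B" "A \<inter> B = {}" "A \<union> B \<subseteq> {1..n}"
    "card A + card B < n - 1 + c" "g \<in> Pol n"
  shows "(\<Prod>m\<in>B. var m) * Sq c (\<Prod>m\<in>A. var m) * g ^ 2 \<in> Low n 1"
  using assms
\<comment> \<open>Variables leave \<open>A\<close> one at a time: one that is not squared moves into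
  \<open>B\<close>, a squared one into \<open>g\<close>.\<close>
proof (induction A arbitrary: B c g rule: finite_induct)
  case empty
  then show ?case
    using prod_var_mult_square_in_Low[of B n g] by (simp add: Sq_one Low_def F2.span_zero)
next
  case (insert x A)
  let ?P = "\<Prod>m\<in>A. var m" and ?Q = "\<Prod>m\<in>B. var m"
  have "x \<in> {1..n}"
    using insert.prems by blast
  then have x: "x \<notin> B" "var x * g \<in> Pol n"
    using insert.prems by (blast, blast intro: Pol_mult var_in_Pol)
  have 1: "(\<Prod>m\<in>insert x B. var m) * Sq c ?P * g ^ 2 \<in> Low n 1"
    by (rule insert.IH) (use insert.prems insert.hyps x in auto)
  show ?case
  proof (cases c)
    case 0
    then show ?thesis
      using 1 insert.hyps insert.prems x by (simp add: mult_ac)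
  next
    case (Suc d)
    \<comment> \<open>Squaring \<open>var x\<close> lowers both \<open>c\<close> and the total
      number of variables by one, so the bound persists.\<close>
    have 2: "?Q * Sq d ?P * (var x * g) ^ 2 \<in> Low n 1"
      by (rule insert.IH) (use insert.prems insert.hyps x Suc in auto)
    have "Sq c (var x * ?P) = (\<Sum>i\<in>{0, 1}. Sq i (var x) * Sq (c - i) ?P)"
      unfolding Sq_mult by (rule sum.mono_neutral_right) (simp_all add: Suc Sq_var)
    also have "\<dots> = var x * Sq c ?P + var x ^ 2 * Sq d ?P"
      by (simp add: Sq_var Suc)
    finally have "?Q * Sq c (var x * ?P) * g ^ 2
        = (\<Prod>m\<in>insert x B. var m) * Sq c ?P * g ^ 2 + ?Q * Sq d ?P * (var x * g) ^ 2"
      using insert.prems x by (simp add: algebra_simps power_mult_distrib)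
    moreover have "\<dots> \<in> Low n 1"
      using 1 2 unfolding Low_def by (rule F2.span_add)
    ultimately show ?thesis
      using insert.hyps by simp
  qed
qed

section \<open>Iterated multiplication by the products omitting one variable\<close>

text \<open>By the Cartan formula the polynomials all of whose squares lie in \<open>Pol n\<close>
  are closed under products.\<close>

lemma Sq_in_Pol:
  assumes "f \<in> Pol n"
  shows "Sq j f \<in> Pol n"
proof -
  define M where "M = {f. \<forall>j. Sq j f \<in> Pol n}"
  have zero: "0 \<in> Pol n"
    by (simp add: Pol_def)
  have one: "1 \<in> M"
    by (auto simp: M_def Sq_one one_in_Pol zero)
  have mult: "f * g \<in> M" if "f \<in> M" "g \<in> M" for f g
    using that by (auto simp: M_def Sq_mult intro!: Pol_sum Pol_mult)
  have pow: "f ^ k \<in> M" if "f \<in> M" for f k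
    by (induction k) (simp_all add: one mult that)
  have prod: "prod h A \<in> M" if "\<And>i. i \<in> A \<Longrightarrow> h i \<in> M" for h :: "nat \<Rightarrow> pol" and A
    using that by (induction A rule: infinite_finite_induct) (simp_all add: one mult)
  have var: "var i \<in> M" if "i \<in> {1..n}" for i
    using var_in_Pol[OF that] by (auto simp: M_def Sq_var zero intro: Pol_power)
  have "mon a \<in> M" if "a \<in> Poly_Mapping.keys f" for a
    unfolding mon_eq_prod by (rule prod, rule pow, rule var) (use assms that in \<open>unfold Pol_def, blast\<close>)
  moreover have "Sq j f = (\<Sum>a\<in>Poly_Mapping.keys f. Sq j (mon a))"
    using arg_cong[OF pol_eq_sum_mon[of f], of "Sq j"] by (simp only: Sq_sum)
  ultimately show ?thesis
    by (auto simp: M_def intro: Pol_sum)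
qed

lemma X_omit_mult_square_in_Low:
  assumes "f \<in> Low n k" "a \<in> {1..n}"
  shows "X_omit n a * f ^ 2 \<in> Low n (Suc k)"
  using assms(1) unfolding Low_def[of n k]
proof (induction rule: F2.span_induct_alt)
  case base
  then show ?case
    by (simp add: Low_def F2.span_zero)
next
  case (step c x y)
  then obtain b where "x = mon b" "Poly_Mapping.keys b \<subseteq> {1..n}" "low_weight n k b"
    by blast
  then have "X_omit n a * x ^ 2 \<in> Low n (Suc k)"
    using X_omit_mon_square_in_Low[OF assms(2)] by blast
  then show ?case
    using step(2)
    by (cases c) (simp_all add: Low_def F2.span_add pol_power2_add distrib_left)
qed

text \<open>The term \<open>i = 0\<close> in the Cartan expansion of
  \<open>Sq (2 * j) (X_omit n a * f ^ 2)\<close> is the given polynomial. All other terms apply a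
  positive square to \<open>X_omit n a\<close> and have low weight.\<close>

lemma X_omit_mult_Sq_square_in_hits:
  assumes "1 \<le> j" "j < 2 ^ s" "f \<in> Pol n" "a \<in> {1..n}"
  shows "X_omit n a * Sq j f ^ 2 \<in> hits n (Suc s) (Suc k)"
proof -
  let ?R = "\<Sum>i\<in>{1..2 * j}. Sq i (X_omit n a) * Sq (2 * j - i) (f ^ 2)"
  have "Sq (2 * j) (X_omit n a * f ^ 2) = X_omit n a * Sq j f ^ 2 + ?R"
    unfolding Sq_mult atMost_atLeast0
    by (subst sum.atLeast_Suc_atMost) (simp_all add: Sq_power2)
  then have eq: "X_omit n a * Sq j f ^ 2 = Sq (2 * j) (X_omit n a * f ^ 2) + ?R"
    by (simp add: add.assoc)
  have "Sq i (X_omit n a) * Sq (2 * j - i) (f ^ 2) \<in> Low n 1" if "i \<in> {1..2 * j}" for i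
  proof -
    have "Sq i (X_omit n a) * g ^ 2 \<in> Low n 1" if "g \<in> Pol n" for g
    proof -
      have "card ({1..n} - {a}) + card {} < n - 1 + i"
        using \<open>i \<in> {1..2 * j}\<close> assms(4) by auto
      then show ?thesis
        using Sq_prod_var_mult_square_in_Low[of "{1..n} - {a}" "{}" n i g] that
        by (simp add: X_omit_def)
    qed
    \<comment> \<open>By \<open>Sq_power2\<close> the second factor is 0 or again a square.\<close>
    then show ?thesis
      using Sq_in_Pol[OF assms(3)] by (simp add: Sq_power2 Low_def F2.span_zero)
  qed
  then have "?R \<in> hits n (Suc s) 1"
    using Low_subset_hits by (intro hits_sum) blast
  then have "?R \<in> hits n (Suc s) (Suc k)"
    using hits_mono[of "Suc s" "Suc s" 1 "Suc k" n] by auto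
  moreover have "Sq (2 * j) (X_omit n a * f ^ 2) \<in> hits n (Suc s) (Suc k)"
    by (rule Sq_in_hits) (use assms in \<open>auto intro: Pol_mult Pol_power X_omit_in_Pol\<close>)
  ultimately show ?thesis
    unfolding eq by (rule hits_add[rotated])
qed

text \<open>The map h -> X_a h^2 is additive, so the two kinds of generators can be treated
  separately.\<close>

lemma X_omit_mult_square_in_hits:
  assumes "h \<in> hits n s k" "a \<in> {1..n}"
  shows "X_omit n a * h ^ 2 \<in> hits n (Suc s) (Suc k)"
  using assms(1) unfolding hits_def[of n s k]
proof (induction rule: F2.span_induct_alt)
  case base
  then show ?case
    by simp
next
  case (step c x y)
  have "X_omit n a * x ^ 2 \<in> hits n (Suc s) (Suc k)"
    using step(1)
  proof
    assume "x \<in> {Sq j (mon b) | j b. 1 \<le> j \<and> j < 2 ^ s \<and> Poly_Mapping.keys b \<subseteq> {1..n}}"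
    then show ?thesis
      using X_omit_mult_Sq_square_in_hits[OF _ _ _ assms(2)] mon_in_Pol by blast
  next
    assume "x \<in> {mon b | b. Poly_Mapping.keys b \<subseteq> {1..n} \<and> low_weight n k b}"
    then show ?thesis
      using X_omit_mon_square_in_Low[OF assms(2)] Low_subset_hits by blast
  qed
  then show ?case
    using step(2) by (cases c) (simp_all add: hits_add pol_power2_add distrib_left)
qed

fun omit_word :: "nat \<Rightarrow> nat list \<Rightarrow> pol \<Rightarrow> pol"
  where
    "omit_word n [] y = y"
  | "omit_word n (a # v) y = X_omit n a * omit_word n v y ^ 2"

lemma omit_word_append: "omit_word n (v @ w) y = omit_word n v (omit_word n w y)"
  by (induction v) simp_all

lemma omit_word_sum: "omit_word n v (sum f A) = (\<Sum>i\<in>A. omit_word n v (f i))"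
  by (induction v) (simp_all add: pol_power2_sum sum_distrib_left)

lemma omit_word_in_Pol: "y \<in> Pol n \<Longrightarrow> omit_word n v y \<in> Pol n"
  by (induction v) (simp_all add: Pol_mult Pol_power X_omit_in_Pol)

lemma omit_word_in_hits:
  "h \<in> hits n s k \<Longrightarrow> set v \<subseteq> {1..n} \<Longrightarrow> omit_word n v h \<in> hits n (length v + s) (length v + k)"
  by (induction v) (simp_all add: X_omit_mult_square_in_hits)

text \<open>Sq^1 is a derivation taking x_u to x_u^2.\<close>

lemma Sq1_prod_var:
  "finite A \<Longrightarrow> Sq 1 (\<Prod>m\<in>A. var m) = (\<Sum>u\<in>A. var u * (\<Prod>m\<in>A. var m))"
proof (induction A rule: finite_induct)
  case (insert x A)
  then show ?case
    by (simp add: Sq_mult Sq_var sum_distrib_left power2_eq_square algebra_simps)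
qed (simp add: Sq_one)

lemma prod_var_eq_X_omit: "u \<in> {1..n} \<Longrightarrow> (\<Prod>m\<in>{1..n}. var m) = var u * X_omit n u"
  unfolding X_omit_def by (rule prod.remove) auto

text \<open>Sq^1 annihilates squares, and P = x_u X_u turns x_u P q^2 into X_u (x_u q)^2.\<close>

lemma Sq1_prod_var_mult_square:
  "Sq 1 ((\<Prod>m\<in>{1..n}. var m) * q ^ 2) = (\<Sum>u\<in>{1..n}. X_omit n u * (var u * q) ^ 2)"
proof -
  have "Sq 1 ((\<Prod>m\<in>{1..n}. var m) * q ^ 2) = Sq 1 (\<Prod>m\<in>{1..n}. var m) * q ^ 2"
    using Sq_power2[of 1 q] by (simp add: Sq_mult[of _ _ "q ^ 2"])
  also have "\<dots> = (\<Sum>u\<in>{1..n}. var u * (\<Prod>m\<in>{1..n}. var m) * q ^ 2)"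
    by (simp only: Sq1_prod_var finite_atLeastAtMost sum_distrib_right)
  also have "\<dots> = (\<Sum>u\<in>{1..n}. X_omit n u * (var u * q) ^ 2)"
    by (rule sum.cong) (simp_all only: prod_var_eq_X_omit power_mult_distrib power2_eq_square mult_ac)
  finally show ?thesis .
qed

lemma sum_X_omit_in_hits:
  assumes "q \<in> Pol n"
  shows "(\<Sum>u\<in>{1..n}. X_omit n u * (var u * q) ^ 2) \<in> hits n 1 k"
  unfolding Sq1_prod_var_mult_square[symmetric]
  by (rule Sq_in_hits) (auto intro!: Pol_mult Pol_prod Pol_power var_in_Pol assms)

lemma two_terms_in_hits:
  assumes "(\<Sum>u\<in>{1..n}. T u) \<in> hits n s k" "a \<in> {1..n}" "b \<in> {1..n}" "a \<noteq> b"
    and "\<And>u. u \<in> {1..n} - {a, b} \<Longrightarrow> T u \<in> hits n s k"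
  shows "T a + T b \<in> hits n s k"
proof -
  have "(\<Sum>u\<in>{1..n}. T u) = sum T {a, b} + sum T ({1..n} - {a, b})"
    by (rule sum.subset_diff[THEN trans, OF _ _ add.commute]) (use assms in auto)
  then have "T a + T b = (\<Sum>u\<in>{1..n}. T u) + sum T ({1..n} - {a, b})"
    using assms(4) by (simp add: add.assoc)
  moreover have "sum T ({1..n} - {a, b}) \<in> hits n s k"
    by (rule hits_sum) (rule assms(5))
  ultimately show ?thesis
    using assms(1) by (simp only: hits_add)
qed

context
  fixes n a b y
  assumes ab: "a \<in> {1..n}" "b \<in> {1..n}" "a \<noteq> b" and y: "y \<in> Pol n"
begin

text \<open>This is P / (x_a x_b): a further factor x_a gives X_b, and x_b gives X_a.\<close>

private definition "W = (\<Prod>m\<in>{1..n} - {a, b}. var m)"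

private lemma var_W: "var a * W = X_omit n b" "var b * W = X_omit n a"
proof -
  have "insert a ({1..n} - {a, b}) = {1..n} - {b}" "insert b ({1..n} - {a, b}) = {1..n} - {a}"
    using ab by auto
  then show "var a * W = X_omit n b" "var b * W = X_omit n a"
    unfolding W_def X_omit_def
    by (metis (no_types) DiffE finite_Diff finite_atLeastAtMost insertI1 prod.insert
        insert_commute)+
qed

private lemma W_in_Pol: "W \<in> Pol n"
  unfolding W_def by (rule Pol_prod) (auto intro: var_in_Pol)

text \<open>The variable x_u now occurs squared, so only \<open>n - 3\<close> variables remain in
  the squarefree part.\<close>

private lemma var_W_in_Low:
  assumes u: "u \<in> {1..n} - {a, b}"
  shows "var u * W * y ^ 2 \<in> Low n 1"
proof -
  let ?B = "{1..n} - {a, b, u}"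
  have "{1..n} - {a, b} = insert u ?B"
    using u by auto
  then have "W = var u * (\<Prod>m\<in>?B. var m)"
    by (simp add: W_def)
  then have "var u * W * y ^ 2 = (\<Prod>m\<in>?B. var m) * (var u * y) ^ 2"
    by (simp add: power2_eq_square mult_ac)
  \<comment> \<open>The bound on \<open>n\<close> guards \<open>n - 3 < n - 1\<close> against
    truncated subtraction.\<close>
  moreover have "card ?B = n - 3" "n \<ge> 3"
  proof -
    have c: "card {a, b, u} = 3" and s: "{a, b, u} \<subseteq> {1..n}"
      using ab u by auto
    show "card ?B = n - 3"
      using card_Diff_subset[of "{a, b, u}" "{1..n}"] c s by simp
    show "n \<ge> 3"
      using card_mono[OF _ s] c by simp
  qed
  moreover have "var u * y \<in> Pol n"
    using u by (intro Pol_mult var_in_Pol y) blast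
  ultimately show ?thesis
    using prod_var_mult_square_in_Low[of ?B n "var u * y"] by auto
qed

text \<open>
  In both relations only the terms \<open>u = a\<close> and \<open>u = b\<close> of \<open>Sq\<^sup>1(P q\<^sup>2) = \<Sum>\<^sub>u X\<^sub>u (x\<^sub>u q)\<^sup>2\<close> are not of
  low weight.
\<close>

lemma omit_word_swap: "omit_word n [a, b] y + omit_word n [b, a] y \<in> hits n 1 2"
proof -
  \<comment> \<open>For q = W y^2 one has x_a q = X_b y^2 and x_b q = X_a y^2, so the terms at
    \<open>a\<close> and \<open>b\<close> are the two words.\<close>
  let ?T = "\<lambda>u. X_omit n u * (var u * (W * y ^ 2)) ^ 2"
  have "?T a + ?T b \<in> hits n 1 2"
  proof (rule two_terms_in_hits[OF sum_X_omit_in_hits ab])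
    show "W * y ^ 2 \<in> Pol n"
      by (intro Pol_mult Pol_power W_in_Pol y)
    fix u assume u: "u \<in> {1..n} - {a, b}"
    show "?T u \<in> hits n 1 2"
      using X_omit_mult_square_in_Low[OF var_W_in_Low[OF u], of u] u Low_subset_hits
      by (auto simp: mult.assoc numeral_2_eq_2)
  qed
  then show ?thesis
    by (simp add: mult.assoc[symmetric] var_W)
qed

lemma omit_word_exchange: "omit_word n [a, a, b] y + omit_word n [b, b, a] y \<in> hits n 1 3"
proof -
  \<comment> \<open>The factor P doubles the first letter, since x_u P h^2 = X_u (x_u h)^2.\<close>
  let ?q = "(\<Prod>m\<in>{1..n}. var m) * (W * y ^ 2) ^ 2"
  let ?T = "\<lambda>u. X_omit n u * (var u * ?q) ^ 2"
  have q: "var u * ?q = X_omit n u * (var u * W * y ^ 2) ^ 2" if "u \<in> {1..n}" for u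
    by (simp only: prod_var_eq_X_omit[OF that] power_mult_distrib power2_eq_square mult_ac)
  have "?T a + ?T b \<in> hits n 1 3"
  proof (rule two_terms_in_hits[OF sum_X_omit_in_hits ab])
    show "?q \<in> Pol n"
      by (intro Pol_mult Pol_power Pol_prod var_in_Pol W_in_Pol y)
    fix u assume u: "u \<in> {1..n} - {a, b}"
    have "X_omit n u * (X_omit n u * (var u * W * y ^ 2) ^ 2) ^ 2 \<in> Low n (Suc (Suc 1))"
      using u by (intro X_omit_mult_square_in_Low var_W_in_Low) auto
    then have "?T u \<in> Low n 3"
      using u by (subst q) (simp_all add: numeral_3_eq_3)
    then show "?T u \<in> hits n 1 3"
      using Low_subset_hits by blast
  qed
  then show ?thesis
    by (simp only: q ab(1,2) var_W omit_word.simps)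
qed

end

section \<open>Words with the same letters\<close>

text \<open>The congruence generated by the two relations. Prefixes enter through
  \<open>Cons\<close>, which mirrors h -> X_a h^2; suffixes are the tails \<open>v\<close>, absorbed
  later into the arbitrary \<open>y\<close>.\<close>

inductive word_eq :: "nat list \<Rightarrow> nat list \<Rightarrow> bool"
  where
    refl: "word_eq v v"
  | sym: "word_eq v w \<Longrightarrow> word_eq w v"
  | trans: "word_eq u v \<Longrightarrow> word_eq v w \<Longrightarrow> word_eq u w"
  | Cons: "word_eq v w \<Longrightarrow> word_eq (a # v) (a # w)"
  | swap: "word_eq (a # b # v) (b # a # v)"
  | exchange: "word_eq (a # a # b # v) (b # b # a # v)"

lemma word_eq_length: "word_eq v w \<Longrightarrow> length v = length w"
  by (induction rule: word_eq.induct) auto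

lemma word_eq_set: "word_eq v w \<Longrightarrow> set v = set w"
  by (induction rule: word_eq.induct) auto

lemma word_eq_move: "word_eq (a # v @ w) (v @ a # w)"
proof (induction v)
  case (Cons b v)
  then show ?case
    using word_eq.trans[OF word_eq.swap word_eq.Cons] by simp
qed (simp add: word_eq.refl)

text \<open>Swaps of neighbours generate all permutations.\<close>

lemma word_eq_mset: "mset v = mset w \<Longrightarrow> word_eq v w"
proof (induction v arbitrary: w)
  case Nil
  then show ?case
    by (simp add: word_eq.refl)
next
  case (Cons a v)
  then have "a \<in> set w"
    by (metis list.set_intros(1) mset_eq_setD)
  then obtain w1 w2 where w: "w = w1 @ a # w2"
    by (auto dest: split_list)
  then have "word_eq v (w1 @ w2)"
    using Cons by simp
  then show ?case
    unfolding w using word_eq.trans[OF word_eq.Cons word_eq_move] by blast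
qed

lemma word_eq_repeated_letter:
  assumes "\<not> distinct v"
  obtains a w where "word_eq v (a # a # w)"
proof -
  obtain xs ys zs a where "v = xs @ [a] @ ys @ [a] @ zs"
    using not_distinct_decomp[OF assms] by blast
  then have "word_eq v (a # a # xs @ ys @ zs)"
    by (intro word_eq_mset) simp
  then show ?thesis
    by (rule that)
qed

lemma word_eq_letter:
  assumes "a \<in> set v"
  obtains w where "word_eq v (a # w)"
proof -
  obtain xs ys where "v = xs @ a # ys"
    using assms by (auto dest: split_list)
  then have "word_eq v (a # xs @ ys)"
    by (intro word_eq_mset) simp
  then show ?thesis
    by (rule that)
qed

text \<open>Words without repetition are permutations of each other. Otherwise
  \<open>exchange\<close> turns a repeated \<open>a\<close> into a repeated \<open>b\<close> that
  \<open>w\<close> repeats too; removing one \<open>b\<close> from both words preserves their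
  letters, and induction on the length applies.\<close>

lemma word_eq_same_letters:
  assumes "length v = length w" "set v = set w"
  shows "word_eq v w"
  using assms
proof (induction "length v" arbitrary: v w rule: less_induct)
  case less
  show ?case
  proof (cases "distinct v")
    case True
    \<comment> \<open>Being distinct depends only on the length and the number of letters, which
      \<open>v\<close> and \<open>w\<close> share.\<close>
    then have "distinct w"
      using less.prems by (metis card_distinct distinct_card)
    then show ?thesis
      using True less.prems by (intro word_eq_mset) (simp add: set_eq_iff_mset_eq_distinct)
  next
    case False
    then have "\<not> distinct w"
      using less.prems by (metis card_distinct distinct_card)
    obtain a v0 where v: "word_eq v (a # a # v0)"
      using word_eq_repeated_letter[OF False] .
    obtain b w0 where w: "word_eq w (b # b # w0)"
      using word_eq_repeated_letter[OF \<open>\<not> distinct w\<close>] .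
    note v' = word_eq_length[OF v] word_eq_set[OF v]
    note w' = word_eq_length[OF w] word_eq_set[OF w]
    have tail: "word_eq (b # z) (b # b # w0)"
      if "length v = Suc (length z)" "set z = set v" for z
    proof -
      have "word_eq z (b # w0)"
        by (rule less.hyps) (use that w' less.prems in auto)
      then show ?thesis
        by (rule word_eq.Cons)
    qed
    have "word_eq v (b # b # w0)"
    proof (cases "a = b")
      case True
      have "word_eq (b # a # v0) (b # b # w0)"
        by (rule tail) (use v' True in auto)
      then show ?thesis
        using v True word_eq.trans by blast
    next
      case False
      then have "b \<in> set v0"
        using v' w' less.prems by auto
      then obtain z where z: "word_eq v0 (b # z)"
        by (rule word_eq_letter)
      have "word_eq v (a # a # b # z)"
        using v word_eq.trans word_eq.Cons[OF word_eq.Cons[OF z]] by blast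
      then have "word_eq v (b # b # a # z)"
        using word_eq.trans word_eq.exchange by blast
      moreover have "word_eq (b # b # a # z) (b # b # w0)"
        by (rule tail) (use v' word_eq_length[OF z] word_eq_set[OF z] in auto)
      ultimately show ?thesis
        by (rule word_eq.trans)
    qed
    then show ?thesis
      using w word_eq.trans word_eq.sym by blast
  qed
qed

text \<open>Sums are differences in characteristic 2. \<open>Cons\<close> raises both levels of
  \<open>hits\<close> along with the length; the two basic relations have weight levels 2 and 3, at
  most the length of their words.\<close>

lemma omit_word_eq:
  assumes "word_eq v w" "set v \<subseteq> {1..n}" "y \<in> Pol n"
  shows "omit_word n v y + omit_word n w y \<in> hits n (length v) (length v)"
  using assms
proof (induction rule: word_eq.induct)
  case (sym v w)
  then show ?case
    using word_eq_length[of v w] word_eq_set[of v w] by (simp add: add.commute)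
next
  case (trans u v w)
  have "(omit_word n u y + omit_word n v y) + (omit_word n v y + omit_word n w y)
      \<in> hits n (length u) (length u)"
    by (rule hits_add)
      (use trans word_eq_length[of u v] word_eq_set[of u v] in auto)
  moreover have "(omit_word n u y + omit_word n v y) + (omit_word n v y + omit_word n w y)
      = omit_word n u y + omit_word n w y + (omit_word n v y + omit_word n v y)"
    by (simp only: add_ac)
  ultimately show ?case
    by simp
next
  case (Cons v w a)
  then show ?case
    using X_omit_mult_square_in_hits[of "omit_word n v y + omit_word n w y" n "length v" "length v" a]
    by (simp add: pol_power2_add distrib_left)
next
  case (swap a b v)
  then show ?case
  proof (cases "a = b")
    case False
    then have "omit_word n [a, b] (omit_word n v y) + omit_word n [b, a] (omit_word n v y) \<in> hits n 1 2"
      using swap by (intro omit_word_swap omit_word_in_Pol) auto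
    then show ?thesis
      using hits_mono[of 1 "length (a # b # v)" 2 "length (a # b # v)" n] by auto
  qed simp
next
  case (exchange a b v)
  then show ?case
  proof (cases "a = b")
    case False
    then have "omit_word n [a, a, b] (omit_word n v y) + omit_word n [b, b, a] (omit_word n v y)
        \<in> hits n 1 3"
      using exchange by (intro omit_word_exchange omit_word_in_Pol) auto
    then show ?thesis
      using hits_mono[of 1 "length (a # a # b # v)" 3 "length (a # a # b # v)" n] by auto
  qed simp
qed simp

section \<open>Sums over sets of letters\<close>

lemma double_power_2_diff_1: "2 * 2 ^ k - 1 = Suc (2 * (2 ^ k - 1 :: nat))"
  using one_le_power[of "2 :: nat" k] by linarith

lemma power_regroup:
  fixes x y z :: "'a::comm_semiring_1"
  shows "(x * y) ^ p * (y ^ q * z ^ s) ^ t = x ^ p * y ^ (p + q * t) * z ^ (s * t)"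
  by (simp add: power_mult_distrib power_add power_mult mult_ac)

lemma sorted_list_of_set_strict_sorted:
  fixes xs :: "nat list"
  shows "sorted_wrt (<) xs \<Longrightarrow> sorted_list_of_set (set xs) = xs"
  by (intro sorted_list_of_set.idem_if_sorted_distinct) (simp_all add: strict_sorted_iff)

lemma omit_word_replicate:
  "omit_word n (replicate k a) y = X_omit n a ^ (2 ^ k - 1) * y ^ (2 ^ k)"
proof (induction k)
  case (Suc k)
  have "omit_word n (replicate (Suc k) a) y = X_omit n a * (X_omit n a ^ (2 ^ k - 1) * y ^ 2 ^ k) ^ 2"
    using Suc by simp
  also have "\<dots> = X_omit n a ^ Suc (2 * (2 ^ k - 1)) * y ^ (2 * 2 ^ k)"
    by (simp add: power_mult_distrib power_mult[symmetric] mult_ac)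
  finally show ?case
    by (simp only: double_power_2_diff_1 power_Suc)
qed simp

text \<open>A representative of the class \<open>[S | y]\<close>; \<open>Min S\<close> is one
  possible choice of padding letter in \<open>S\<close>.\<close>

definition std_word :: "nat \<Rightarrow> nat set \<Rightarrow> nat list"
  where "std_word l S = replicate (l - card S) (Min S) @ sorted_list_of_set S"

lemma std_word:
  assumes "finite S" "S \<noteq> {}" "card S \<le> l"
  shows "length (std_word l S) = l" "set (std_word l S) = S"
  using assms Min_in[of S] by (auto simp: std_word_def simp del: Min_in)

lemma std_word_singleton: "l > 0 \<Longrightarrow> std_word l {a} = replicate l a"
  by (cases l) (simp_all add: std_word_def replicate_append_same)

lemma omit_word_std_word:
  assumes "set v \<subseteq> {1..n}" "v \<noteq> []" "y \<in> Pol n"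
  shows "omit_word n v y + omit_word n (std_word (length v) (set v)) y
    \<in> hits n (length v) (length v)"
  by (rule omit_word_eq[OF word_eq_same_letters]) (use assms std_word[of "set v" "length v"] card_length[of v] in auto)

lemma hits_from_sum: "f + g \<in> hits n s k \<Longrightarrow> f \<in> hits n s k \<Longrightarrow> g \<in> hits n s k"
  using hits_add[of f n s k "f + g"] by (simp add: add.assoc[symmetric])

text \<open>As \<open>card S < l\<close>, a nonempty \<open>S\<close> is the letter set of a word of
  length \<open>l - 1\<close>, which is put in front of the relation for q = 1. The empty set offers
  no letter for this and takes a power of P as q instead.\<close>

lemma sum_std_word_in_hits:
  assumes "S \<subseteq> {1..n}" "card S < l"
  shows "(\<Sum>u\<in>{1..n}. omit_word n (std_word l (insert u S)) (var u)) \<in> hits n l l"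
proof (cases "S = {}")
  case True
  obtain k where l: "l = Suc k"
    using assms by (cases l) auto
  \<comment> \<open>For q = P^(2^k - 1) the product x_u q is X_u^(2^k - 1) x_u^(2^k), the word of
    \<open>k\<close> letters \<open>u\<close>.\<close>
  have "omit_word n (replicate l u) (var u)
      = X_omit n u * (var u * (\<Prod>m\<in>{1..n}. var m) ^ (2 ^ k - 1)) ^ 2" if "u \<in> {1..n}" for u
  proof -
    have "var u ^ 2 ^ k = var u * var u ^ (2 ^ k - 1)"
      using power_minus_mult[of "2 ^ k" "var u"] by (simp add: mult.commute)
    then have "omit_word n (replicate k u) (var u) = var u * (\<Prod>m\<in>{1..n}. var m) ^ (2 ^ k - 1)"
      unfolding omit_word_replicate prod_var_eq_X_omit[OF that] power_mult_distrib
      by (simp only: mult_ac)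
    then show ?thesis
      by (simp only: l replicate_Suc omit_word.simps)
  qed
  then have "(\<Sum>u\<in>{1..n}. omit_word n (replicate l u) (var u)) \<in> hits n 1 l"
    using sum_X_omit_in_hits[of "(\<Prod>m\<in>{1..n}. var m) ^ (2 ^ k - 1)" n l]
      Pol_power[OF Pol_prod[OF var_in_Pol, of "{1..n}"]]
    by simp
  then show ?thesis
    using hits_mono[of 1 l l l n] assms True by (auto simp: std_word_singleton)
next
  case False
  have fin: "finite S"
    using assms(1) finite_subset by blast
  define g where "g = std_word (l - 1) S"
  have g: "length g = l - 1" "set g = S"
    using std_word[OF fin False, of "l - 1"] assms(2) by (simp_all add: g_def)
  have "(\<Sum>u\<in>{1..n}. X_omit n u * var u ^ 2) \<in> hits n 1 1"
    using sum_X_omit_in_hits[OF one_in_Pol, of n 1] by simp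
  from omit_word_in_hits[OF this, of g]
  have "omit_word n g (\<Sum>u\<in>{1..n}. X_omit n u * var u ^ 2) \<in> hits n l l"
    using g assms by simp
  then have 1: "(\<Sum>u\<in>{1..n}. omit_word n (g @ [u]) (var u)) \<in> hits n l l"
    by (simp add: omit_word_append omit_word_sum)
  have 2: "(\<Sum>u\<in>{1..n}. omit_word n (g @ [u]) (var u)
      + omit_word n (std_word l (insert u S)) (var u)) \<in> hits n l l"
  proof (rule hits_sum)
    fix u assume u: "u \<in> {1..n}"
    have "set (g @ [u]) = insert u S" "length (g @ [u]) = l"
      using g assms(2) by auto
    then show "omit_word n (g @ [u]) (var u) + omit_word n (std_word l (insert u S)) (var u) \<in> hits n l l"
      using omit_word_std_word[of "g @ [u]" n "var u"] u assms(1) var_in_Pol[OF u] by auto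
  qed
  show ?thesis
    using hits_from_sum[OF 2[unfolded sum.distrib] 1] .
qed

text \<open>The subsets containing \<open>u\<close> cancel against those not containing \<open>u\<close>.\<close>

lemma sum_Pow_insert_eq_0:
  fixes f :: "nat set \<Rightarrow> pol"
  assumes "finite A" "u \<in> A"
  shows "(\<Sum>S\<in>Pow A. f (insert u S)) = 0"
proof -
  let ?B = "A - {u}"
  have A: "Pow A = Pow ?B \<union> insert u ` Pow ?B"
    using assms(2) Pow_insert[of u ?B] by (simp add: insert_absorb)
  have inj: "inj_on (insert u) (Pow ?B)"
    by (rule inj_onI) (metis Diff_insert_absorb PowD subset_Diff_insert)
  have "(\<Sum>S\<in>Pow A. f (insert u S))
      = (\<Sum>S\<in>Pow ?B. f (insert u S)) + (\<Sum>S\<in>insert u ` Pow ?B. f (insert u S))"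
    unfolding A using assms by (intro sum.union_disjoint) auto
  also have "(\<Sum>S\<in>insert u ` Pow ?B. f (insert u S)) = (\<Sum>S\<in>Pow ?B. f (insert u S))"
    by (simp add: sum.reindex[OF inj])
  finally show ?thesis
    by simp
qed

lemma sum_Pow_in_hits:
  assumes "0 < l" "l \<le> n"
  shows "(\<Sum>u\<in>{l..n}. \<Sum>S\<in>Pow {1..l - 1}. omit_word n (std_word l (insert u S)) (var u)) \<in> hits n l l"
proof -
  let ?t = "\<lambda>u S. omit_word n (std_word l (insert u S)) (var u)"
  have "(\<Sum>S\<in>Pow {1..l - 1}. \<Sum>u\<in>{1..n}. ?t u S) \<in> hits n l l"
  proof (rule hits_sum, rule sum_std_word_in_hits)
    fix S assume S: "S \<in> Pow {1..l - 1}"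
    then have "card S \<le> card {1..l - 1}"
      by (intro card_mono) auto
    then show "card S < l"
      using assms by simp
    have "{1..l - 1} \<subseteq> {1..n}"
      using assms by auto
    with S show "S \<subseteq> {1..n}"
      by blast
  qed
  moreover have "{1..n} = {1..l - 1} \<union> {l..n}"
    using assms by auto
  then have "(\<Sum>u\<in>{1..n}. \<Sum>S\<in>Pow {1..l - 1}. ?t u S)
      = (\<Sum>u\<in>{1..l - 1}. \<Sum>S\<in>Pow {1..l - 1}. ?t u S) + (\<Sum>u\<in>{l..n}. \<Sum>S\<in>Pow {1..l - 1}. ?t u S)"
    by (simp only:) (rule sum.union_disjoint; use assms in auto)
  moreover have "(\<Sum>u\<in>{1..l - 1}. \<Sum>S\<in>Pow {1..l - 1}. ?t u S) = 0"
    by (intro sum.neutral ballI sum_Pow_insert_eq_0[where f = "\<lambda>S. omit_word n (std_word l S) _"]) simp_all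
  ultimately show ?thesis
    by (subst (asm) sum.swap) simp
qed

text \<open>A pair (i; I) is the increasing enumeration of a nonempty set with its minimum split
  off.\<close>

lemma sum_Nset:
  "(\<Sum>(i, I)\<in>Nset m. f (insert i (set I))) = (\<Sum>S\<in>Pow {1..m} - {{}}. f S)"
proof -
  have "(\<Sum>p\<in>Nset m. f (insert (fst p) (set (snd p)))) = (\<Sum>S\<in>Pow {1..m} - {{}}. f S)"
  proof (rule sum.reindex_bij_witness[of _
        "\<lambda>S. (hd (sorted_list_of_set S), tl (sorted_list_of_set S))"
        "\<lambda>(i, I). insert i (set I)"])
    fix p assume "p \<in> Nset m"
    then obtain i I where p: "p = (i, I)" "sorted_wrt (<) (i # I)" "set (i # I) \<subseteq> {1..m}"
      by (auto simp: Nset_def)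
    have "sorted_list_of_set (set (i # I)) = i # I"
      using p(2) by (rule sorted_list_of_set_strict_sorted)
    then show "(\<lambda>S. (hd (sorted_list_of_set S), tl (sorted_list_of_set S))) ((\<lambda>(i, I). insert i (set I)) p) = p"
      by (simp only: p(1) case_prod_conv list.set(2) list.sel)
    show "(\<lambda>(i, I). insert i (set I)) p \<in> Pow {1..m} - {{}}"
      using p by auto
    show "f ((\<lambda>(i, I). insert i (set I)) p) = f (insert (fst p) (set (snd p)))"
      by (simp add: p(1))
  next
    fix S assume "S \<in> Pow {1..m} - {{}}"
    then have S: "finite S" "S \<noteq> {}" "S \<subseteq> {1..m}"
      using finite_subset by auto
    then have "sorted_list_of_set S \<noteq> []"
      by simp
    then obtain i I where I: "sorted_list_of_set S = i # I"
      by (meson neq_Nil_conv)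
    have set: "set (i # I) = S" and len: "length (i # I) = card S"
      by (simp_all only: I[symmetric] set_sorted_list_of_set[OF S(1)] length_sorted_list_of_set)
    have srt: "sorted_wrt (<) (i # I)"
      unfolding I[symmetric] by (simp add: strict_sorted_iff)
    show "(\<lambda>(i, I). insert i (set I)) (hd (sorted_list_of_set S), tl (sorted_list_of_set S)) = S"
      using set I by simp
    have "card S \<le> m"
      using card_mono[OF _ S(3)] by simp
    then show "(hd (sorted_list_of_set S), tl (sorted_list_of_set S)) \<in> Nset m"
      using set len srt S(3) I by (auto simp: Nset_def)
  qed
  then show ?thesis
    by (simp add: case_prod_unfold)
qed

section \<open>The maps \<open>\<phi>\<close> on powers of \<open>X\<close>\<close>

lemma mon_power: "\<exists>a. mon e ^ k = mon a \<and> (\<forall>j. nu j a = k * nu j e)"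
proof (induction k)
  case 0
  show ?case
    by (rule exI[of _ 0]) (simp add: mon_zero)
next
  case (Suc k)
  then obtain a where "mon e ^ k = mon a" "\<forall>j. nu j a = k * nu j e"
    by blast
  then show ?case
    by (intro exI[of _ "e + a"]) (simp add: mon_mult lookup_add)
qed

lemma alpha_mask: "alpha k (2 ^ l - 1) = (if k < l then 1 else 0)"
proof -
  have "odd ((2 ^ l - 1) div 2 ^ k :: nat) \<longleftrightarrow> k < l"
    using bit_mask_iff[of l k, where 'a = nat] by (simp add: bit_iff_odd mask_eq_exp_minus_1)
  then show ?thesis
    by (simp only: alpha_def mod_2_eq_odd of_bool_def)
qed

lemma f_hom_mult: "f_hom i (f * g) = f_hom i f * f_hom i g"
  unfolding f_hom_def by (rule evalp_mult) (simp_all add: single_add)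

lemma f_hom_one: "f_hom i 1 = 1"
  by (simp add: f_hom_def evalp_def)

lemma f_hom_power: "f_hom i (f ^ k) = f_hom i f ^ k"
  by (induction k) (simp_all add: f_hom_one f_hom_mult)

lemma f_hom_prod: "f_hom i (prod f A) = (\<Prod>m\<in>A. f_hom i (f m))"
  by (induction A rule: infinite_finite_induct) (simp_all add: f_hom_one f_hom_mult)

lemma f_hom_var: "f_hom i (var j) = (if j < i then var j else var (j + 1))"
  unfolding f_hom_def by (rule evalp_var) (simp_all add: single_add)

lemma f_hom_X_all:
  assumes "i \<in> {1..n}"
  shows "f_hom i (X_all n) = X_omit n i"
proof -
  have "f_hom i (X_all n) = (\<Prod>j\<in>{1..n - 1}. var (if j < i then j else j + 1))"
    unfolding X_all_def f_hom_prod f_hom_var by (rule prod.cong) auto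
  also have "\<dots> = X_omit n i"
    unfolding X_omit_def
    by (rule prod.reindex_bij_witness[of _ "\<lambda>m. if m < i then m else m - 1" "\<lambda>j. if j < i then j else j + 1"])
      (use assms in auto)
  finally show ?thesis .
qed

text \<open>The p-th factor of the word, with exponent 2^p, is completed to P^(2^p), and these
  exponents add up to 2^l - 1 for a word of length l. The product form avoids division, as in
  \<open>phi_mon_mult\<close>.\<close>

lemma omit_word_mult_prod:
  assumes "set v \<subseteq> {1..n}"
  shows "omit_word n v y * (\<Prod>p<length v. var (v ! p) ^ 2 ^ p)
    = (\<Prod>m\<in>{1..n}. var m) ^ (2 ^ length v - 1) * y ^ 2 ^ length v"
  using assms
proof (induction v)
  case (Cons a v)
  let ?P = "\<Prod>m\<in>{1..n}. var m" and ?k = "length v"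
  have "(\<Prod>p<length (a # v). var ((a # v) ! p) ^ 2 ^ p) = var a * (\<Prod>p<?k. var (v ! p) ^ 2 ^ p) ^ 2"
    by (simp add: prod.lessThan_Suc_shift prod_power_distrib power_mult[symmetric] mult_ac del: prod.lessThan_Suc)
  then have "omit_word n (a # v) y * (\<Prod>p<length (a # v). var ((a # v) ! p) ^ 2 ^ p)
      = (var a * X_omit n a) * (omit_word n v y * (\<Prod>p<?k. var (v ! p) ^ 2 ^ p)) ^ 2"
    by (simp only: omit_word.simps power_mult_distrib mult_ac)
  also have "\<dots> = ?P * (?P ^ (2 ^ ?k - 1) * y ^ 2 ^ ?k) ^ 2"
    using Cons prod_var_eq_X_omit[of a n] by simp
  also have "\<dots> = ?P ^ Suc (2 * (2 ^ ?k - 1)) * y ^ (2 * 2 ^ ?k)"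
    by (simp add: power_mult_distrib power_mult[symmetric] mult_ac)
  finally show ?case
    by (simp only: double_power_2_diff_1 power_Suc list.size add_0_right add_Suc_right)
qed simp

text \<open>For u = 1 the first entry has exponent 2^(r-1), in line with 2^(r-t) for the others;
  reversal moves entry t to position r - t.\<close>

lemma x_sub_1:
  assumes "J \<noteq> []"
  shows "x_sub J 1 = (\<Prod>p<length J. var (rev J ! p) ^ 2 ^ p)"
proof -
  let ?r = "length J"
  have r: "?r \<ge> 1"
    using assms by (cases J) auto
  then have "{1..?r} = insert 1 {1<..?r}"
    by auto
  then have "x_sub J 1 = (\<Prod>t\<in>{1..?r}. var (entry J t) ^ 2 ^ (?r - t))"
    by (simp add: x_sub_def Let_def)
  also have "\<dots> = (\<Prod>p<?r. var (rev J ! p) ^ 2 ^ p)"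
    by (rule prod.reindex_bij_witness[of _ "\<lambda>p. ?r - p" "\<lambda>t. ?r - t"]) (auto simp: rev_nth)
  finally show ?thesis .
qed

text \<open>All exponents of X^(2^l - 1) equal 2^l - 1, whose digits below \<open>l\<close> are 1,
  so u = 1 is the compatible index. The two sides are compared after multiplication by the nonzero
  \<open>x_sub J 1\<close>.\<close>

lemma phi_X_all_power:
  assumes srt: "sorted_wrt (<) (i # J)" and set: "set (i # J) \<subseteq> {1..n}"
    and J: "J \<noteq> []" "length J < l"
  shows "phi i J (X_all n ^ (2 ^ l - 1)) * y ^ 2 ^ l
    = omit_word n (rev J @ replicate (l - length J) i) y"
proof -
  let ?r = "length J" and ?P = "\<Prod>m\<in>{1..n}. var m"
  obtain a where a: "X_all n ^ (2 ^ l - 1) = mon a" "\<And>j. nu j a = (2 ^ l - 1) * nu j (sqfree {1..n - 1})"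
    using mon_power[of "sqfree {1..n - 1}" "2 ^ l - 1"] by (auto simp: X_all_def prod_var_eq_mon)
  have nu: "nu (entry J t - 1) a = 2 ^ l - 1" if "t \<in> {1..?r}" for t
  proof -
    have "entry J t \<in> set J"
      using that by (intro nth_mem) auto
    then have "i < entry J t" "entry J t \<in> {1..n}" "i \<in> {1..n}"
      using srt set by auto
    then have "entry J t - 1 \<in> {1..n - 1}"
      by auto
    then show ?thesis
      by (simp add: a(2) nu_sqfree)
  qed
  have r: "1 \<in> {1..?r}"
    using J(1) by (cases J) auto
  have lt: "(2 :: nat) ^ ?r - 1 < 2 ^ l - 1"
    using J(2) power_strict_increasing[of ?r l "2 :: nat"] one_le_power[of "2 :: nat" ?r] by linarith
  have "compatible J 1 a"
    unfolding compatible_def Let_def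
  proof (intro conjI ballI)
    show "1 \<le> (1 :: nat)" "1 \<le> ?r"
      using r by auto
    show "2 ^ ?r - 1 < nu (entry J 1 - 1) a"
      using nu[OF r] lt by simp
    fix t
    show "nu (entry J t - 1) a = 2 ^ ?r - 1" if "t \<in> {1..<1}"
      using that by simp
    show "alpha (?r - t) (nu (entry J 1 - 1) a) = 1" if "t \<in> {1..1}"
      using nu[OF r] J(2) alpha_mask[of "?r - t" l] by auto
    show "alpha (?r - t) (nu (entry J t - 1) a) = 1" if "t \<in> {1<..?r}"
      using nu[of t] that J(2) alpha_mask[of "?r - t" l] by auto
  qed
  from phi_mon_mult[OF srt this]
  have "phi_mon i J a * x_sub J 1 = var i ^ (2 ^ ?r - 1) * X_omit n i ^ (2 ^ l - 1)"
    using set by (simp add: a(1)[symmetric] f_hom_power f_hom_X_all)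
  moreover have "phi i J (X_all n ^ (2 ^ l - 1)) = phi_mon i J a"
    unfolding a(1) using J(1) by (simp add: phi_def mon_def)
  moreover have "phi_mon i J a * y ^ 2 ^ l * x_sub J 1 = phi_mon i J a * x_sub J 1 * y ^ 2 ^ l"
    by (simp only: mult_ac)
  ultimately have phi: "phi i J (X_all n ^ (2 ^ l - 1)) * y ^ 2 ^ l * x_sub J 1
      = var i ^ (2 ^ ?r - 1) * X_omit n i ^ (2 ^ l - 1) * y ^ 2 ^ l"
    by (simp only:)
  have "omit_word n (rev J @ replicate (l - ?r) i) y * x_sub J 1
      = ?P ^ (2 ^ ?r - 1) * (X_omit n i ^ (2 ^ (l - ?r) - 1) * y ^ 2 ^ (l - ?r)) ^ 2 ^ ?r"
    using omit_word_mult_prod[of "rev J" n "omit_word n (replicate (l - ?r) i) y"] set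
    unfolding x_sub_1[OF J(1)] omit_word_append omit_word_replicate by simp
  \<comment> \<open>Writing P = x_i X_i supplies the power of x_i and the missing powers of
    X_i.\<close>
  also have "\<dots> = var i ^ (2 ^ ?r - 1)
      * X_omit n i ^ ((2 ^ ?r - 1) + (2 ^ (l - ?r) - 1) * 2 ^ ?r) * y ^ (2 ^ (l - ?r) * 2 ^ ?r)"
    using prod_var_eq_X_omit[of i n] set by (simp only: power_regroup list.set insert_subset)
  also have pow: "2 ^ (l - ?r) * 2 ^ ?r = (2 ^ l :: nat)"
    using J(2) by (simp add: power_add[symmetric])
  also have "(2 ^ ?r - 1) + (2 ^ (l - ?r) - 1) * 2 ^ ?r = (2 ^ l - 1 :: nat)"
    using pow lt by (simp add: diff_mult_distrib)
  finally have "omit_word n (rev J @ replicate (l - ?r) i) y * x_sub J 1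
      = phi i J (X_all n ^ (2 ^ l - 1)) * y ^ 2 ^ l * x_sub J 1"
    unfolding phi .
  then show ?thesis
    using x_sub_nonzero by simp
qed

section \<open>Degrees and weights\<close>

lemma sum_alpha: "(\<Sum>k<N. 2 ^ k * alpha k x) = x mod 2 ^ N"
proof (induction N)
  case (Suc N)
  have "x mod (2 ^ N * 2) = 2 ^ N * (x div 2 ^ N mod 2) + x mod 2 ^ N"
    by (rule mod_mult2_eq)
  then show ?case
    using Suc by (simp add: alpha_def mult.commute)
qed simp

text \<open>A double sum over variables and binary digits, evaluated in both orders.\<close>

lemma deg_weight_weight: "deg_weight (weight a) = deg_expo a"
proof -
  \<comment> \<open>The degree also bounds the number of digits: every exponent is at most
    \<open>?N\<close>, hence below 2^N.\<close>
  let ?N = "deg_expo a" and ?K = "Poly_Mapping.keys a"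
  have lt: "nu j a < 2 ^ ?N" if "j \<in> ?K" for j
  proof -
    have "nu j a \<le> ?N"
      unfolding deg_expo_def using that by (intro member_le_sum) auto
    then show ?thesis
      using less_exp[of ?N] by linarith
  qed
  have "weight a i = 0" if "i > ?N" for i
  proof -
    have "alpha (i - 1) (nu j a) = 0" if j: "j \<in> ?K" for j
    proof -
      have "nu j a < 2 ^ (i - 1)"
        using lt[OF j] power_increasing[of ?N "i - 1" "2 :: nat"] \<open>i > ?N\<close> by linarith
      then show ?thesis
        by (simp add: alpha_def)
    qed
    then show ?thesis
      by (simp add: weight_def)
  qed
  then have "deg_weight (weight a) = (\<Sum>i\<in>{1..?N}. 2 ^ (i - 1) * weight a i)"
    unfolding deg_weight_def by (intro sum.mono_neutral_left) (auto simp: not_less[symmetric])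
  also have "\<dots> = (\<Sum>k<?N. 2 ^ k * weight a (Suc k))"
    by (rule sum.reindex_bij_witness[of _ Suc "\<lambda>i. i - 1"]) auto
  also have "\<dots> = (\<Sum>k<?N. \<Sum>j\<in>?K. 2 ^ k * alpha k (nu j a))"
    by (simp add: weight_def sum_distrib_left)
  also have "\<dots> = (\<Sum>j\<in>?K. \<Sum>k<?N. 2 ^ k * alpha k (nu j a))"
    by (rule sum.swap)
  also have "\<dots> = deg_expo a"
    using lt by (simp add: sum_alpha deg_expo_def)
  finally show ?thesis .
qed

lemma homogeneous_X_omit:
  assumes "a \<in> {1..n}"
  shows "homogeneous (n - 1) (X_omit n a)"
  using homogeneous_prod_var[of "{1..n} - {a}"] assms by (simp add: X_omit_def)

lemma homogeneous_omit_word: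
  "set v \<subseteq> {1..n} \<Longrightarrow> homogeneous ((n - 1) * (2 ^ length v - 1) + 2 ^ length v) (omit_word n v (var u))"
proof (induction v)
  case Nil
  then show ?case
    using homogeneous_var[of u] by simp
next
  case (Cons a v)
  let ?d = "(n - 1) * (2 ^ length v - 1) + 2 ^ length v"
  have "homogeneous (n - 1 + (?d + ?d)) (omit_word n (a # v) (var u))"
    unfolding omit_word.simps power2_eq_square
    by (intro homogeneous_mult homogeneous_X_omit Cons.IH) (use Cons.prems in auto)
  moreover have "n - 1 + (?d + ?d) = (n - 1) * Suc (2 * (2 ^ length v - 1)) + 2 * 2 ^ length v"
    by (simp only: mult_Suc_right distrib_left mult_2 add_ac)
  then have "n - 1 + (?d + ?d) = (n - 1) * (2 ^ length (a # v) - 1) + 2 ^ length (a # v)"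
    by (simp only: list.size add_0_right add_Suc_right double_power_2_diff_1 power_Suc)
  ultimately show ?case
    by metis
qed

text \<open>Gives the left side of the theorem as \<open>mon a\<close>, the form in which
  \<open>simeq\<close> takes its weight.\<close>

lemma spike_exponents:
  assumes "l \<in> {1..n}"
  shows "\<exists>a. X_omit n l ^ (2 ^ k - 1) * var l ^ (2 ^ k) = mon a \<and>
    (\<forall>j. nu j a = (if j = l then 2 ^ k else if j \<in> {1..n} then 2 ^ k - 1 else 0))"
proof -
  obtain b where b: "X_omit n l ^ (2 ^ k - 1) = mon b"
    "\<And>j. nu j b = (2 ^ k - 1) * nu j (sqfree ({1..n} - {l}))"
    using mon_power[of "sqfree ({1..n} - {l})" "2 ^ k - 1"] by (auto simp: X_omit_eq_mon)
  obtain c where c: "var l ^ 2 ^ k = mon c" "\<And>j. nu j c = 2 ^ k * nu j (Poly_Mapping.single l 1)"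
    using mon_power[of "Poly_Mapping.single l 1" "2 ^ k"] by (auto simp: var_def)
  show ?thesis
  proof (intro exI conjI allI)
    show "X_omit n l ^ (2 ^ k - 1) * var l ^ 2 ^ k = mon (b + c)"
      by (simp only: b c mon_mult)
    show "nu j (b + c) = (if j = l then 2 ^ k else if j \<in> {1..n} then 2 ^ k - 1 else 0)" for j
      by (auto simp: b c lookup_add nu_sqfree lookup_single when_def)
  qed
qed

text \<open>The first \<open>k\<close> weights of \<open>a\<close> are \<open>n - 1\<close>:
  exponents 2^k - 1 contribute 1 each, the exponent 2^k at \<open>l\<close> contributes 0. Low
  weight is decided in these places.\<close>

lemma low_weight_imp_weight_less:
  assumes "l \<in> {1..n}" "low_weight n k b"
    and a: "\<And>j. nu j a = (if j = l then 2 ^ k else if j \<in> {1..n} then 2 ^ k - 1 else 0)"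
  shows "weight_less (weight b) (weight a)"
proof -
  have "weight a i = n - 1" if "i \<in> {1..k}" for i
  proof -
    have "Poly_Mapping.keys a \<subseteq> {1..n}"
      using assms(1) by (auto simp: in_keys_iff a split: if_splits)
    then have "weight a i = (\<Sum>j\<in>{1..n}. alpha (i - 1) (nu j a))"
      by (intro weight_superset) auto
    also have "\<dots> = (\<Sum>j\<in>{1..n}. if j = l then 0 else 1)"
    proof (rule sum.cong)
      fix j assume "j \<in> {1..n}"
      have "alpha (i - 1) (2 ^ k) = 0"
        using \<open>i \<in> {1..k}\<close> by (auto simp: alpha_def power_diff[symmetric] simp flip: power_Suc)
      then show "alpha (i - 1) (nu j a) = (if j = l then 0 else 1)"
        using \<open>j \<in> {1..n}\<close> that alpha_mask[of "i - 1" k] by (simp only: a) auto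
    qed simp
    also have "\<dots> = (\<Sum>j\<in>{1..n} - {l}. 1)"
      by (rule sum.mono_neutral_cong_right) auto
    also have "\<dots> = n - 1"
      using assms(1) by simp
    finally show ?thesis .
  qed
  moreover obtain j where j: "j \<ge> 1" "weight b j < (if j \<le> k then n - 1 else 0)"
    "\<forall>i\<in>{1..<j}. weight b i = (if i \<le> k then n - 1 else 0)"
    using assms(2) unfolding low_weight_def weight_less_def by blast
  moreover have "j \<le> k"
    using j(2) by (simp split: if_splits)
  ultimately show ?thesis
    unfolding weight_less_def by (intro exI[of _ j]) auto
qed

text \<open>The generators are homogeneous, so those of degree \<open>d\<close> suffice. The degree
  is kept only for the monomials of low weight, where \<open>P_minus\<close> asks for it.\<close>

lemma hits_homogeneous:
  assumes "h \<in> hits n s k" "homogeneous d h"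
  shows "\<exists>f g. h = f + g \<and> f \<in> A_plus_P s n \<and>
    g \<in> F2.span {mon b | b. Poly_Mapping.keys b \<subseteq> {1..n} \<and> low_weight n k b \<and> deg_expo b = d}"
proof -
  let ?A = "{Sq j (mon b) | j b. 1 \<le> j \<and> j < 2 ^ s \<and> Poly_Mapping.keys b \<subseteq> {1..n}}"
  let ?L = "{mon b | b. Poly_Mapping.keys b \<subseteq> {1..n} \<and> low_weight n k b}"
  let ?M = "{mon b | b. Poly_Mapping.keys b \<subseteq> {1..n} \<and> low_weight n k b \<and> deg_expo b = d}"
  have "h \<in> F2.span {g \<in> ?A \<union> ?L. homogeneous d g}"
  proof (rule homogeneous_in_span)
    show "homogeneous d h" "h \<in> F2.span (?A \<union> ?L)"
      using assms by (simp_all add: hits_def)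
    show "\<exists>e. homogeneous e g" if "g \<in> ?A \<union> ?L" for g
      using that homogeneous_Sq_mon homogeneous_mon by blast
  qed
  also have "\<dots> \<subseteq> F2.span (?A \<union> ?M)"
    by (rule F2.span_mono) (auto simp: homogeneous_mon)
  finally obtain f g where fg: "h = f + g" "f \<in> F2.span ?A" "g \<in> F2.span ?M"
    unfolding F2.span_Un by blast
  have "F2.span ?A \<subseteq> A_plus_P s n"
    unfolding A_plus_P_def by (rule F2.span_mono) (use mon_in_Pol in blast)
  then show ?thesis
    using fg by blast
qed

theorem proposition3p8:
  fixes n l :: nat
  assumes "n \<ge> 1" and "0 < l" and "l \<le> n"
  shows "simeq n l (X_omit n l ^ (2 ^ l - 1) * var l ^ (2 ^ l))
    ((\<Sum>u = l..n. \<Sum>(i, I) \<in> Nset (l - 1).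
        phi i (insert_entry I u) (X_all n ^ (2 ^ l - 1)) * var u ^ (2 ^ l)) +
     (\<Sum>u = l + 1..n. X_omit n u ^ (2 ^ l - 1) * var u ^ (2 ^ l)))"
proof -
  \<comment> \<open>The words from \<open>phi_X_all_power\<close> for \<open>I @ [u]\<close>:
    \<open>u\<close> comes first and \<open>i\<close> is the padding.\<close>
  let ?w = "\<lambda>u i I. rev (I @ [u]) @ replicate (l - Suc (length I)) i"
  let ?f = "X_omit n l ^ (2 ^ l - 1) * var l ^ (2 ^ l)"
  let ?T = "\<Sum>u = l..n. \<Sum>(i, I) \<in> Nset (l - 1). omit_word n (?w u i I) (var u)"
  let ?R = "\<Sum>u = l + 1..n. X_omit n u ^ (2 ^ l - 1) * var u ^ (2 ^ l)"
  let ?d = "(n - 1) * (2 ^ l - 1) + 2 ^ l"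
  let ?s = "\<lambda>u S. omit_word n (std_word l (insert u S)) (var u)"
  \<comment> \<open>Entries from \<open>Nset (l - 1)\<close> are below \<open>l\<close>, hence below
    \<open>u\<close>, and the length bound leaves room for at least one \<open>i\<close>.\<close>
  have N: "sorted_wrt (<) (i # I @ [u])" "set (i # I @ [u]) \<subseteq> {1..n}" "Suc (length I) < l"
    if "(i, I) \<in> Nset (l - 1)" "u \<in> {l..n}" for i I u
    using that assms by (fastforce simp: Nset_def sorted_wrt_append)+
  have phi: "phi i (insert_entry I u) (X_all n ^ (2 ^ l - 1)) * var u ^ (2 ^ l)
      = omit_word n (?w u i I) (var u)" if "(i, I) \<in> Nset (l - 1)" "u \<in> {l..n}" for i I u
  proof -
    note N' = N[OF that]
    have "insert_entry I u = I @ [u]"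
      using N'(1) sorted_list_of_set_strict_sorted[of "I @ [u]"]
      unfolding insert_entry_def by simp
    then show ?thesis
      using phi_X_all_power[of i "I @ [u]" n l "var u"] N' by simp
  qed
  have wd: "set (?w u i I) = insert u (insert i (set I))" "length (?w u i I) = l"
    if "(i, I) \<in> Nset (l - 1)" "u \<in> {l..n}" for i I u
    using N[OF that] by (auto simp: insert_commute)
  have powers: "X_omit n u ^ (2 ^ l - 1) * var u ^ (2 ^ l) = omit_word n (replicate l u) (var u)" for u
    by (simp add: omit_word_replicate)
  have rep: "omit_word n (replicate l u) (var u) \<in> Pol n"
    "homogeneous ?d (omit_word n (replicate l u) (var u))" if "u \<in> {l..n}" for u
    using that assms homogeneous_omit_word[of "replicate l u" n u]
    by (auto intro!: omit_word_in_Pol var_in_Pol)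
  have word: "omit_word n (?w u i I) (var u) \<in> Pol n"
    "homogeneous ?d (omit_word n (?w u i I) (var u))" if "(i, I) \<in> Nset (l - 1)" "u \<in> {l..n}" for u i I
  proof -
    have "set (?w u i I) \<subseteq> {1..n}"
      unfolding wd(1)[OF that] using N(2)[OF that] by simp
    from homogeneous_omit_word[OF this, of u] show "homogeneous ?d (omit_word n (?w u i I) (var u))"
      by (simp only: wd(2)[OF that])
    show "omit_word n (?w u i I) (var u) \<in> Pol n"
      using N(2)[OF that] by (intro omit_word_in_Pol var_in_Pol) simp
  qed
  \<comment> \<open>The empty set contributes the words with \<open>u\<close> as their only letter;
    \<open>u = l\<close> is the left side of the theorem.\<close>
  have fR: "?f + ?R = (\<Sum>u = l..n. ?s u {})"
    using assms unfolding powers by (simp add: sum.atLeast_Suc_atMost std_word_singleton)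
  have S: "(\<Sum>S\<in>Pow {1..l - 1}. ?s u S) = ?s u {} + (\<Sum>(i, I)\<in>Nset (l - 1). ?s u (insert i (set I)))" for u
    unfolding sum_Nset[of "?s u"] by (rule sum.remove[of _ "{}" "?s u" for u]) auto
  have 1: "(\<Sum>u = l..n. \<Sum>(i, I)\<in>Nset (l - 1). ?s u (insert i (set I))) + (?f + ?R) \<in> hits n l l"
    using sum_Pow_in_hits[OF assms(2,3)] unfolding S fR sum.distrib by (simp only: add.commute)
  \<comment> \<open>Replaces canonical words by those of \<open>phi\<close>, which have the same
    letters and length.\<close>
  have 2: "(\<Sum>u = l..n. \<Sum>(i, I)\<in>Nset (l - 1). ?s u (insert i (set I))) + ?T \<in> hits n l l"
  proof -
    have "(\<Sum>u = l..n. \<Sum>p\<in>Nset (l - 1). ?s u (insert (fst p) (set (snd p)))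
        + omit_word n (?w u (fst p) (snd p)) (var u)) \<in> hits n l l"
    proof (rule hits_sum, rule hits_sum)
      fix u p assume u: "u \<in> {l..n}" and p: "p \<in> Nset (l - 1)"
      then have iI: "(fst p, snd p) \<in> Nset (l - 1)"
        by simp
      show "?s u (insert (fst p) (set (snd p))) + omit_word n (?w u (fst p) (snd p)) (var u) \<in> hits n l l"
        using omit_word_std_word[of "?w u (fst p) (snd p)" n "var u"] N(2)[OF iI u]
        unfolding wd[OF iI u] by (simp add: var_in_Pol add.commute)
    qed
    then show ?thesis
      by (simp only: sum.distrib case_prod_unfold)
  qed
  \<comment> \<open>The sum over canonical words occurs twice and cancels.\<close>
  have "?f - (?T + ?R) = ((\<Sum>u = l..n. \<Sum>(i, I)\<in>Nset (l - 1). ?s u (insert i (set I))) + (?f + ?R))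
      + ((\<Sum>u = l..n. \<Sum>(i, I)\<in>Nset (l - 1). ?s u (insert i (set I))) + ?T)"
    (is "_ = (?C + _) + (?C + _)")
  proof -
    have "(?C + (?f + ?R)) + (?C + ?T) = (?C + ?C) + (?f + (?T + ?R))"
      by (simp only: add_ac)
    then show ?thesis
      by (simp only: pol_minus pol_add_self add_0_left)
  qed
  then have diff: "?f - (?T + ?R) \<in> hits n l l"
    using hits_add[OF 1 2] by (simp only:)
  have l: "l \<in> {1..n}" "l \<in> {l..n}"
    using assms by auto
  have f: "?f \<in> Pol n" "homogeneous ?d ?f"
    using rep[OF l(2)] by (simp_all only: powers)
  have R: "?T + ?R \<in> Pol n" "homogeneous ?d (?T + ?R)"
  proof -
    show "?T + ?R \<in> Pol n"
      unfolding powers case_prod_unfold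
      by (intro Pol_add Pol_sum rep(1) word(1)) simp_all
    show "homogeneous ?d (?T + ?R)"
      unfolding powers case_prod_unfold
      by (intro homogeneous_add homogeneous_sum rep(2) word(2)) simp_all
  qed
  obtain a where a: "?f = mon a" "\<And>j. nu j a = (if j = l then 2 ^ l else if j \<in> {1..n} then 2 ^ l - 1 else 0)"
    using spike_exponents[OF l(1), of l] by blast
  have "homogeneous ?d (?f - (?T + ?R))"
    using homogeneous_add[OF f(2) R(2)] by (simp only: pol_minus)
  from hits_homogeneous[OF diff this] obtain g h where gh: "?f - (?T + ?R) = g + h" "g \<in> A_plus_P l n"
    "h \<in> F2.span {mon b | b. Poly_Mapping.keys b \<subseteq> {1..n} \<and> low_weight n l b \<and> deg_expo b = ?d}"
    by (elim exE conjE)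
  have "deg_expo a = ?d"
    using f(2) by (simp only: a(1) homogeneous_mon)
  \<comment> \<open>Low weight and degree \<open>?d\<close> yield the two conditions in
    \<open>P_minus\<close>.\<close>
  then have "{mon b | b. Poly_Mapping.keys b \<subseteq> {1..n} \<and> low_weight n l b \<and> deg_expo b = ?d}
      \<subseteq> {mon b | b. mon b \<in> Pol n \<and> deg_expo b = deg_weight (weight a) \<and> weight_less (weight b) (weight a)}"
    using low_weight_imp_weight_less[OF l(1) _ a(2)] by (auto simp: mon_in_Pol deg_weight_weight)
  then have "h \<in> P_minus n (weight a)"
    using gh(3) F2.span_mono unfolding P_minus_def by blast
  then have "simeq n l ?f (?T + ?R)"
    unfolding simeq_def simeq_weight_def using a(1) f R gh(1,2) by blast
  moreover have "?T = (\<Sum>u = l..n. \<Sum>(i, I) \<in> Nset (l - 1).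
      phi i (insert_entry I u) (X_all n ^ (2 ^ l - 1)) * var u ^ (2 ^ l))"
    by (intro sum.cong refl) (auto simp only: phi split: prod.splits)
  ultimately show ?thesis
    by (simp only:)
qed

end
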